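(* Let $\rho$ be the abelian complexity function of the Rudin-Shapiro sequence, extended to real $x>0$ by $\rho(x):=\rho(\lfloor x\rfloor)$, and let $\lambda(x)=\lim_{k\to\infty}\rho(4^k x)/\sqrt{4^k x}$ for $x>0$. Then for every bounded non-degenerate interval $I\subset(0,+\infty)$, the box dimension of the graph $\{(x,\lambda(x)) : x\in I\}\subset\mathbb{R}^2$ exists and equals $3/2$.
   Context: The Rudin-Shapiro sequence $\mathbf{r}=(r(n))_{n\ge 0}\in\{-1,1\}^{\mathbb{N}}$ is defined by $r(0)=1$, $r(2n)=r(n)$, $r(2n+1)=(-1)^n r(n)$ for $n\ge 0$. Its abelian complexity is $\rho(n)=\#(\mathcal{F}_{\mathbf{r}}(n)/\sim_{ab})$, where $\mathcal{F}_{\mathbf{r}}(n)=\{r(i)\cdots r(i+n-1): i\ge 0\}$ is the set of factors of length $n$ and $u\sim_{ab}v$ means that each letter occurs equally often in $u$ and in $v$ (so $\rho(0)=1$). The limit defining $\lambda(x)$ exists for every $x>0$. Box dimension: for $\delta>0$, a $\delta$-mesh square is a set $[m_1\delta,(m_1+1)\delta]\times[m_2\delta,(m_2+1)\delta]$ with $m_1,m_2\in\mathbb{Z}$. For a non-empty bounded $F\subset\mathbb{R}^2$, let $N_\delta(F)$ be the number of $\delta$-mesh squares that intersect $F$. The upper and lower box dimensions of $F$ are $\limsup_{\delta\to0}\frac{\log N_\delta(F)}{-\log\delta}$ and $\liminf_{\delta\to0}\frac{\log N_\delta(F)}{-\log\delta}$; if they agree, the common value is the box dimension $\dim_B F$.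 *)

theory Defs
  imports "HOL-Analysis.Analysis"
begin

fun rudin_shapiro :: "nat \<Rightarrow> int" where
  "rudin_shapiro n =
     (if n = 0 then 1
      else if even n then rudin_shapiro (n div 2)
      else (-1) ^ (n div 2) * rudin_shapiro (n div 2))"

declare rudin_shapiro.simps [simp del]

lemma rudin_shapiro_0: "rudin_shapiro 0 = 1"
  by (simp add: rudin_shapiro.simps)

lemma rudin_shapiro_even: "rudin_shapiro (2 * n) = rudin_shapiro n"
  by (cases "n = 0") (simp_all add: rudin_shapiro.simps [of "2 * n"] rudin_shapiro_0)

lemma rudin_shapiro_odd: "rudin_shapiro (2 * n + 1) = (-1) ^ n * rudin_shapiro n"
  by (subst rudin_shapiro.simps) simp

definition factors :: "(nat \<Rightarrow> 'a) \<Rightarrow> nat \<Rightarrow> 'a list set" where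
  "factors w n = {map w [i..<i + n] | i. True}"

definition ab_equiv :: "'a list \<Rightarrow> 'a list \<Rightarrow> bool" where
  "ab_equiv u v \<longleftrightarrow> (\<forall>a. count_list u a = count_list v a)"

definition abelian_complexity :: "(nat \<Rightarrow> 'a) \<Rightarrow> nat \<Rightarrow> nat" where
  "abelian_complexity w n =
     card (factors w n // {(u, v). u \<in> factors w n \<and> v \<in> factors w n \<and> ab_equiv u v})"

definition rho :: "real \<Rightarrow> real" where
  "rho x = real (abelian_complexity rudin_shapiro (nat \<lfloor>x\<rfloor>))"

definition lambda_fun :: "real \<Rightarrow> real" where
  "lambda_fun x = lim (\<lambda>k::nat. rho (4 ^ k * x) / sqrt (4 ^ k * x))"

definition mesh_squares :: "real \<Rightarrow> (real \<times> real) set set" where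
  "mesh_squares \<delta> =
     {{of_int m1 * \<delta>..(of_int m1 + 1) * \<delta>} \<times> {of_int m2 * \<delta>..(of_int m2 + 1) * \<delta>} | m1 m2 :: int. True}"

definition mesh_count :: "real \<Rightarrow> (real \<times> real) set \<Rightarrow> nat" where
  "mesh_count \<delta> F = card {Q \<in> mesh_squares \<delta>. Q \<inter> F \<noteq> {}}"

definition upper_box_dim :: "(real \<times> real) set \<Rightarrow> ereal" where
  "upper_box_dim F = Limsup (at_right 0) (\<lambda>\<delta>. ereal (ln (real (mesh_count \<delta> F)) / (- ln \<delta>)))"

definition lower_box_dim :: "(real \<times> real) set \<Rightarrow> ereal" where
  "lower_box_dim F = Liminf (at_right 0) (\<lambda>\<delta>. ereal (ln (real (mesh_count \<delta> F)) / (- ln \<delta>)))"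

text \<open>Box dimensions are meaningful only for non-empty bounded sets: for unbounded sets
  \<^const>\<open>mesh_count\<close> may be the cardinality of an infinite set, which is 0.\<close>

definition has_box_dim :: "(real \<times> real) set \<Rightarrow> real \<Rightarrow> bool" where
  "has_box_dim F d \<longleftrightarrow>
     F \<noteq> {} \<and> bounded F \<and> lower_box_dim F = ereal d \<and> upper_box_dim F = ereal d"

end

theory Submission
  imports Defs
begin

text \<open>
The function \<open>\<lambda>\<close> behaves at every scale \<open>h\<close> like a curve of Hoelder exponent exactly \<open>1/2\<close>: over a
window of length \<open>h\<close> it moves by an amount comparable to \<open>sqrt h\<close>. Such a window, covered by squares of
side \<open>h\<close>, needs about \<open>sqrt h / h\<close> of them, so the whole graph needs about \<open>h powr (-3/2)\<close>.

The oscillation comes from two properties of the complexity \<open>\<rho>\<close>: \<open>\<rho> (4n) = 2 \<rho> n + 1\<close> for \<open>n \<ge> 1\<close>, and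
\<open>\<bar>\<rho> (n + 1) - \<rho> n\<bar> = 1\<close>. By the first one, \<open>\<mu> x = \<lambda> x * sqrt x\<close>, the limit of \<open>\<rho> (4\<^sup>k x) / 2\<^sup>k\<close>, exists, is
within \<open>4 / 2\<^sup>k\<close> of its \<open>k\<close>-th approximant, and takes the value \<open>(\<rho> n + 1) / 2\<^sup>k\<close> at \<open>n / 4\<^sup>k\<close>. By the
second one, the values of \<open>\<mu>\<close> at two neighbouring points of the grid \<open>\<nat> / 4\<^sup>k\<close> differ by exactly
\<open>1 / 2\<^sup>k\<close> (lower bound), while approximants at points \<open>1 / 4\<^sup>k\<close> apart differ by at most \<open>1 / 2\<^sup>k\<close> (upper bound).
Division by the smooth function \<open>sqrt x\<close> does not affect this away from \<open>0\<close>; the interval may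
however reach down to \<open>0\<close>, where \<open>\<lambda>\<close> oscillates faster. There the column number \<open>m\<close> of the mesh has
oscillation \<open>O (1 / sqrt m)\<close>, and \<open>\<Sum> 1 / sqrt m\<close> still has the required order.

The two properties of \<open>\<rho>\<close> are combinatorial. The letters are signs, so abelian classes of factors
correspond to window sums; these form an unbroken progression of step \<open>2\<close>, symmetric about \<open>0\<close>,
whence \<open>\<rho> n = M n + 1\<close> for the largest window sum \<open>M n\<close>. A window of length \<open>4 n + d\<close> is, up to at most
two border letters, twice a window of length \<open>n\<close> or \<open>n + 1\<close>. Whether the border letters contribute
with the right signs depends on the surroundings of the smaller window, and the recurrence for \<open>M\<close>
closes up once one follows only maximal windows with prescribed signs at the two ends: this is
the predicate \<open>extremal\<close>, which propagates from \<open>n\<close> and \<open>n + 1\<close> to \<open>4 n + d\<close>.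
\<close>

section \<open>Window sums of the Rudin-Shapiro sequence under quadruplication\<close>

abbreviation r :: "nat \<Rightarrow> int" where
  "r \<equiv> rudin_shapiro"

definition alt_rs :: "nat \<Rightarrow> int" where
  "alt_rs n = (-1) ^ n * r n"

definition prefix_sum :: "nat \<Rightarrow> int" where
  "prefix_sum n = (\<Sum>k<n. r k)"

definition window_sum :: "nat \<Rightarrow> nat \<Rightarrow> int" where
  "window_sum i n = prefix_sum (i + n) - prefix_sum i"

lemma rudin_shapiro_cases: "r n = 1 \<or> r n = -1"
proof (induction n rule: less_induct)
  case (less n)
  show ?case
  proof (cases "n = 0")
    case False
    then have "r (n div 2) = 1 \<or> r (n div 2) = -1"
      by (intro less) auto
    then show ?thesis
      by (cases "even (n div 2)") (auto simp: rudin_shapiro.simps [of n])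
  qed (simp add: rudin_shapiro_0)
qed

lemma alt_rs_cases: "alt_rs n = 1 \<or> alt_rs n = -1"
  using rudin_shapiro_cases [of n] by (cases "even n") (auto simp: alt_rs_def)

text \<open>The sequence \<open>r\<close> and its alternating companion \<open>n \<mapsto> (-1)\<^sup>n r n\<close> together form the automaton that
generates \<open>r\<close> in base 4: the block of four letters starting at \<open>4 n\<close> is determined by the two signs
at \<open>n\<close>. The companion is needed since it governs the border letters of long windows.\<close>

lemma rudin_shapiro_4:
  "r (4 * n) = r n" "r (4 * n + 1) = r n"
  "r (4 * n + 2) = alt_rs n" "r (4 * n + 3) = - alt_rs n"
proof -
  show "r (4 * n) = r n"
    using rudin_shapiro_even [of "2 * n"] rudin_shapiro_even [of n] by simp
  show "r (4 * n + 1) = r n"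
    using rudin_shapiro_odd [of "2 * n"] rudin_shapiro_even [of n] by simp
  show "r (4 * n + 2) = alt_rs n"
    using rudin_shapiro_even [of "2 * n + 1"] rudin_shapiro_odd [of n]
    by (simp add: alt_rs_def)
  show "r (4 * n + 3) = - alt_rs n"
    using rudin_shapiro_odd [of "2 * n + 1"] rudin_shapiro_odd [of n]
    by (simp add: alt_rs_def numeral_3_eq_3)
qed

lemma alt_rs_4:
  "alt_rs (4 * n) = r n" "alt_rs (4 * n + 1) = - r n"
  "alt_rs (4 * n + 2) = alt_rs n" "alt_rs (4 * n + 3) = alt_rs n"
  unfolding alt_rs_def [of "4 * n"] alt_rs_def [of "4 * n + 1"]
    alt_rs_def [of "4 * n + 2"] alt_rs_def [of "4 * n + 3"] rudin_shapiro_4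
  by simp_all

lemma prefix_sum_Suc: "prefix_sum (n + 1) = prefix_sum n + r n"
  by (simp add: prefix_sum_def)

lemma prefix_sum_4:
  "prefix_sum (4 * n) = 2 * prefix_sum n"
  "prefix_sum (4 * n + 1) = 2 * prefix_sum n + r n"
  "prefix_sum (4 * n + 2) = 2 * prefix_sum n + 2 * r n"
  "prefix_sum (4 * n + 3) = 2 * prefix_sum n + 2 * r n + alt_rs n"
proof -
  have step: "prefix_sum (4 * n + 1) = prefix_sum (4 * n) + r n"
    "prefix_sum (4 * n + 2) = prefix_sum (4 * n) + 2 * r n"
    "prefix_sum (4 * n + 3) = prefix_sum (4 * n) + 2 * r n + alt_rs n"
    "prefix_sum (4 * n + 4) = prefix_sum (4 * n) + 2 * r n" for n
    using prefix_sum_Suc [of "4 * n"] prefix_sum_Suc [of "4 * n + 1"]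
      prefix_sum_Suc [of "4 * n + 2"] prefix_sum_Suc [of "4 * n + 3"] rudin_shapiro_4 [of n]
    by (simp_all add: eval_nat_numeral)
  have *: "prefix_sum (4 * n) = 2 * prefix_sum n"
  proof (induction n)
    case (Suc n)
    then show ?case
      using step(4) [of n] prefix_sum_Suc [of n] by (simp add: add.commute)
  qed (simp add: prefix_sum_def)
  show "prefix_sum (4 * n) = 2 * prefix_sum n"
    "prefix_sum (4 * n + 1) = 2 * prefix_sum n + r n"
    "prefix_sum (4 * n + 2) = 2 * prefix_sum n + 2 * r n"
    "prefix_sum (4 * n + 3) = 2 * prefix_sum n + 2 * r n + alt_rs n"
    using * step [of n] by simp_all
qed

lemma window_sum_Suc_right: "window_sum i (n + 1) = window_sum i n + r (i + n)"
  using prefix_sum_Suc [of "i + n"] by (simp add: window_sum_def)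

lemma window_sum_Suc_left: "window_sum i (n + 1) = r i + window_sum (i + 1) n"
  using prefix_sum_Suc [of i] by (simp add: window_sum_def)

lemma window_sum_0: "window_sum i 0 = 0"
  by (simp add: window_sum_def)

text \<open>A block of four letters sums to \<open>2 r n\<close>, so a window of length \<open>4 n + d\<close> starting at \<open>4 j + e\<close> has twice
the sum of a window of length \<open>n\<close> or \<open>n + 1\<close>, corrected by the letters cut off at both ends. Each
formula is written for the smaller window that makes its upper bound and its extremal choice
readable, which is why some use length \<open>n\<close> and others \<open>n + 1\<close>.\<close>

lemma window_sum_4_0:
  "window_sum (4 * j) (4 * n) = 2 * window_sum j n"
  "window_sum (4 * j + 1) (4 * n) = window_sum j n + window_sum (j + 1) n"
  "window_sum (4 * j + 2) (4 * n) = 2 * window_sum (j + 1) n"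
  "window_sum (4 * j + 3) (4 * n) = 2 * window_sum (j + 1) n + alt_rs (j + n) - alt_rs j"
  using prefix_sum_4 [of j] prefix_sum_4 [of "j + n"] prefix_sum_Suc [of j] prefix_sum_Suc [of "j + n"]
  by (simp_all add: window_sum_def algebra_simps)

lemma window_sum_4_1:
  "window_sum (4 * j) (4 * n + 1) = 2 * window_sum j n + r (j + n)"
  "window_sum (4 * j + 1) (4 * n + 1) = 2 * window_sum (j + 1) n + r j"
  "window_sum (4 * j + 2) (4 * n + 1) = 2 * window_sum (j + 1) n + alt_rs (j + n)"
  "window_sum (4 * j + 3) (4 * n + 1) = 2 * window_sum (j + 1) n - alt_rs j"
  using prefix_sum_4 [of j] prefix_sum_4 [of "j + n"] prefix_sum_4 [of "j + n + 1"]
    prefix_sum_Suc [of j] prefix_sum_Suc [of "j + n"]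
  by (simp_all add: window_sum_def algebra_simps eval_nat_numeral)

lemma window_sum_4_2:
  "window_sum (4 * j) (4 * n + 2) = 2 * window_sum j (n + 1)"
  "window_sum (4 * j + 1) (4 * n + 2) = 2 * window_sum (j + 1) n + r j + alt_rs (j + n)"
  "window_sum (4 * j + 2) (4 * n + 2) = 2 * window_sum (j + 1) n"
  "window_sum (4 * j + 3) (4 * n + 2) = 2 * window_sum (j + 1) n + r (j + n + 1) - alt_rs j"
  using prefix_sum_4 [of j] prefix_sum_4 [of "j + n"] prefix_sum_4 [of "j + n + 1"]
    prefix_sum_Suc [of j] prefix_sum_Suc [of "j + n"]
  by (simp_all add: window_sum_def algebra_simps eval_nat_numeral)

lemma window_sum_4_3:
  "window_sum (4 * j) (4 * n + 3) = 2 * window_sum j (n + 1) + alt_rs (j + n)"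
  "window_sum (4 * j + 1) (4 * n + 3) = 2 * window_sum j (n + 1) - r j"
  "window_sum (4 * j + 2) (4 * n + 3) = 2 * window_sum (j + 1) (n + 1) - r (j + n + 1)"
  "window_sum (4 * j + 3) (4 * n + 3) = 2 * window_sum (j + 1) (n + 1) - alt_rs j"
  using prefix_sum_4 [of j] prefix_sum_4 [of "j + n"] prefix_sum_4 [of "j + n + 1"]
    prefix_sum_Suc [of j] prefix_sum_Suc [of "j + n"] prefix_sum_Suc [of "j + n + 1"]
  by (simp_all add: window_sum_def algebra_simps eval_nat_numeral)

text \<open>Knowing the largest window sum alone is not enough for an induction, since the gain made when
passing from a window to four times its length depends on two signs: that of the companion just
before the window and that at its last position. The strengthening asks for a maximal window, starting
at \<open>j + 1\<close>, where these are \<open>-1\<close> and \<open>+1\<close>, the most favourable values.\<close>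

definition extremal :: "nat \<Rightarrow> int \<Rightarrow> bool" where
  "extremal n s \<longleftrightarrow> (\<forall>i. window_sum i n \<le> s) \<and>
     (\<exists>j. window_sum (j + 1) n = s \<and> alt_rs j = -1 \<and> alt_rs (j + n) = 1)"

lemma extremalE:
  assumes "extremal n s"
  obtains j where "window_sum (j + 1) n = s" "alt_rs j = -1" "alt_rs (j + n) = 1"
  using assms unfolding extremal_def by auto

lemma extremal_le: "extremal n s \<Longrightarrow> window_sum i n \<le> s"
  by (simp add: extremal_def)

lemma residue_mod_4_cases:
  fixes i :: nat
  obtains j where "i = 4 * j" | j where "i = 4 * j + 1"
  | j where "i = 4 * j + 2" | j where "i = 4 * j + 3"
proof -
  have "i = 4 * (i div 4) \<or> i = 4 * (i div 4) + 1 \<or> i = 4 * (i div 4) + 2 \<or> i = 4 * (i div 4) + 3"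
    by presburger
  then show ?thesis
    using that by blast
qed

lemma extremalI:
  assumes "\<And>j. window_sum (4 * j) n \<le> s" "\<And>j. window_sum (4 * j + 1) n \<le> s"
    "\<And>j. window_sum (4 * j + 2) n \<le> s" "\<And>j. window_sum (4 * j + 3) n \<le> s"
    and "window_sum (j + 1) n = s" "alt_rs j = -1" "alt_rs (j + n) = 1"
  shows "extremal n s"
  unfolding extremal_def
proof (intro conjI allI)
  fix i show "window_sum i n \<le> s"
    using assms(1-4) by (cases i rule: residue_mod_4_cases) metis+
qed (use assms in blast)

text \<open>In each of the following steps the four starting positions modulo 4 bound the window sums from
above, and one of them attains the bound. That position must in addition reproduce the two signs,
which singles it out when several attain the maximum: it is \<open>3\<close> for lengths \<open>4 n\<close> and \<open>4 n + 1\<close>, and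
\<open>0\<close> for length \<open>4 n + 3\<close>.\<close>

lemma extremal_4:
  assumes "extremal n s"
  shows "extremal (4 * n) (2 * s + 2)"
proof -
  obtain j where j: "window_sum (j + 1) n = s" "alt_rs j = -1" "alt_rs (j + n) = 1"
    using assms by (rule extremalE)
  show ?thesis
  proof (rule extremalI [where j = "4 * j + 2"])
    fix j
    note le = extremal_le [OF assms, of j] extremal_le [OF assms, of "j + 1"]
    note ab = alt_rs_cases [of j] alt_rs_cases [of "j + n"]
    show "window_sum (4 * j) (4 * n) \<le> 2 * s + 2"
      unfolding window_sum_4_0 using le by linarith
    show "window_sum (4 * j + 1) (4 * n) \<le> 2 * s + 2"
      unfolding window_sum_4_0 using le by linarith
    show "window_sum (4 * j + 2) (4 * n) \<le> 2 * s + 2"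
      unfolding window_sum_4_0 using le by linarith
    show "window_sum (4 * j + 3) (4 * n) \<le> 2 * s + 2"
      unfolding window_sum_4_0 using le ab by linarith
  next
    show "window_sum (4 * j + 2 + 1) (4 * n) = 2 * s + 2"
      using window_sum_4_0(4) [of j n] j by (simp add: numeral_3_eq_3)
    show "alt_rs (4 * j + 2) = -1"
      unfolding alt_rs_4 by (rule j)
    show "alt_rs (4 * j + 2 + 4 * n) = 1"
      using alt_rs_4(3) [of "j + n"] j(3) by (simp add: algebra_simps)
  qed
qed

lemma extremal_4_1:
  assumes "extremal n s"
  shows "extremal (4 * n + 1) (2 * s + 1)"
proof -
  obtain j where j: "window_sum (j + 1) n = s" "alt_rs j = -1" "alt_rs (j + n) = 1"
    using assms by (rule extremalE)
  show ?thesis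
  proof (rule extremalI [where j = "4 * j + 2"])
    fix j
    note le = extremal_le [OF assms, of j] extremal_le [OF assms, of "j + 1"]
    note ab = alt_rs_cases [of j] alt_rs_cases [of "j + n"]
      rudin_shapiro_cases [of j] rudin_shapiro_cases [of "j + n"]
    show "window_sum (4 * j) (4 * n + 1) \<le> 2 * s + 1"
      unfolding window_sum_4_1 using le ab by linarith
    show "window_sum (4 * j + 1) (4 * n + 1) \<le> 2 * s + 1"
      unfolding window_sum_4_1 using le ab by linarith
    show "window_sum (4 * j + 2) (4 * n + 1) \<le> 2 * s + 1"
      unfolding window_sum_4_1 using le ab by linarith
    show "window_sum (4 * j + 3) (4 * n + 1) \<le> 2 * s + 1"
      unfolding window_sum_4_1 using le ab by linarith
  next
    show "window_sum (4 * j + 2 + 1) (4 * n + 1) = 2 * s + 1"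
      using window_sum_4_1(4) [of j n] j by (simp add: numeral_3_eq_3)
    show "alt_rs (4 * j + 2) = -1"
      unfolding alt_rs_4 by (rule j)
    show "alt_rs (4 * j + 2 + (4 * n + 1)) = 1"
      using alt_rs_4(4) [of "j + n"] j(3) by (simp add: algebra_simps eval_nat_numeral)
  qed
qed

lemma extremal_4_3:
  assumes "extremal (n + 1) s"
  shows "extremal (4 * n + 3) (2 * s + 1)"
proof -
  obtain j where j: "window_sum (j + 1) (n + 1) = s" "alt_rs j = -1" "alt_rs (j + (n + 1)) = 1"
    using assms by (rule extremalE)
  show ?thesis
  proof (rule extremalI [where j = "4 * j + 3"])
    fix j
    note le = extremal_le [OF assms, of j] extremal_le [OF assms, of "j + 1"]
    note ab = alt_rs_cases [of j] alt_rs_cases [of "j + n"]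
      rudin_shapiro_cases [of j] rudin_shapiro_cases [of "j + n + 1"]
    show "window_sum (4 * j) (4 * n + 3) \<le> 2 * s + 1"
      unfolding window_sum_4_3 using le ab by linarith
    show "window_sum (4 * j + 1) (4 * n + 3) \<le> 2 * s + 1"
      unfolding window_sum_4_3 using le ab by linarith
    show "window_sum (4 * j + 2) (4 * n + 3) \<le> 2 * s + 1"
      unfolding window_sum_4_3 using le ab by linarith
    show "window_sum (4 * j + 3) (4 * n + 3) \<le> 2 * s + 1"
      unfolding window_sum_4_3 using le ab by linarith
  next
    show "window_sum (4 * j + 3 + 1) (4 * n + 3) = 2 * s + 1"
      using window_sum_4_3(1) [of "j + 1" n] j by (simp add: algebra_simps)
    show "alt_rs (4 * j + 3) = -1"
      unfolding alt_rs_4 by (rule j)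
    show "alt_rs (4 * j + 3 + (4 * n + 3)) = 1"
      using alt_rs_4(3) [of "j + n + 1"] j(3) by (simp add: algebra_simps)
  qed
qed

text \<open>Length \<open>4 n + 2\<close> lies midway between \<open>4 n\<close> and \<open>4 (n + 1)\<close>, and the better of the two neighbours \<open>n\<close>
and \<open>n + 1\<close> provides the maximum. If it is \<open>n + 1\<close>, then a maximal window of length \<open>n + 1\<close> must end in
the letter \<open>1\<close>, so that it is a maximal window of length \<open>n\<close> followed by a \<open>1\<close>.\<close>

lemma extremal_4_2_ascent:
  assumes "\<And>i. window_sum i n \<le> s - 1" and ext: "extremal (n + 1) s"
  shows "extremal (4 * n + 2) (2 * s)"
proof -
  obtain j where j: "window_sum (j + 1) (n + 1) = s" "alt_rs j = -1" "alt_rs (j + (n + 1)) = 1"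
    using ext by (rule extremalE)
  have last: "r (j + n + 1) = 1" "window_sum (j + 1) n = s - 1"
    using window_sum_Suc_right [of "j + 1" n] assms(1) [of "j + 1"] j(1)
      rudin_shapiro_cases [of "j + n + 1"] by (auto simp: algebra_simps)
  show ?thesis
  proof (rule extremalI [where j = "4 * j + 2"])
    fix j
    note le = extremal_le [OF ext, of j] assms(1) [of "j + 1"]
    note ab = alt_rs_cases [of j] alt_rs_cases [of "j + n"]
      rudin_shapiro_cases [of j] rudin_shapiro_cases [of "j + n + 1"]
    show "window_sum (4 * j) (4 * n + 2) \<le> 2 * s"
      unfolding window_sum_4_2 using le ab by linarith
    show "window_sum (4 * j + 1) (4 * n + 2) \<le> 2 * s"
      unfolding window_sum_4_2 using le ab by linarith
    show "window_sum (4 * j + 2) (4 * n + 2) \<le> 2 * s"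
      unfolding window_sum_4_2 using le ab by linarith
    show "window_sum (4 * j + 3) (4 * n + 2) \<le> 2 * s"
      unfolding window_sum_4_2 using le ab by linarith
  next
    show "window_sum (4 * j + 2 + 1) (4 * n + 2) = 2 * s"
      using window_sum_4_2(4) [of j n] j last by (simp add: numeral_3_eq_3)
    show "alt_rs (4 * j + 2) = -1"
      unfolding alt_rs_4 by (rule j)
    show "alt_rs (4 * j + 2 + (4 * n + 2)) = 1"
      using alt_rs_4(1) [of "j + n + 1"] last by (simp add: algebra_simps eval_nat_numeral)
  qed
qed

text \<open>If the better neighbour is \<open>n\<close>, then a maximal window of length \<open>n\<close> must be preceded by the letter
\<open>-1\<close>, as the window extended to the left has a smaller sum.\<close>

lemma extremal_4_2_descent:
  assumes ext: "extremal n s" and "\<And>i. window_sum i (n + 1) \<le> s - 1"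
  shows "extremal (4 * n + 2) (2 * s)"
proof -
  obtain j where j: "window_sum (j + 1) n = s" "alt_rs j = -1" "alt_rs (j + n) = 1"
    using ext by (rule extremalE)
  have first: "r j = -1"
    using window_sum_Suc_left [of j n] assms(2) [of j] j(1) rudin_shapiro_cases [of j] by auto
  show ?thesis
  proof (rule extremalI [where j = "4 * j"])
    fix j
    note le = extremal_le [OF ext, of j] extremal_le [OF ext, of "j + 1"]
      assms(2) [of j] assms(2) [of "j + 1"]
    note ab = alt_rs_cases [of j] alt_rs_cases [of "j + n"]
      rudin_shapiro_cases [of j] rudin_shapiro_cases [of "j + n + 1"]
      window_sum_Suc_left [of j n] window_sum_Suc_right [of "j + 1" n]
    show "window_sum (4 * j) (4 * n + 2) \<le> 2 * s"
      unfolding window_sum_4_2 using le ab by linarith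
    show "window_sum (4 * j + 1) (4 * n + 2) \<le> 2 * s"
      unfolding window_sum_4_2 using le ab by linarith
    show "window_sum (4 * j + 2) (4 * n + 2) \<le> 2 * s"
      unfolding window_sum_4_2 using le ab by linarith
    show "window_sum (4 * j + 3) (4 * n + 2) \<le> 2 * s"
      unfolding window_sum_4_2 using le ab by (auto simp: algebra_simps)
  next
    show "window_sum (4 * j + 1) (4 * n + 2) = 2 * s"
      using window_sum_4_2(2) [of j n] j first by simp
    show "alt_rs (4 * j) = -1"
      unfolding alt_rs_4 by (rule first)
    show "alt_rs (4 * j + (4 * n + 2)) = 1"
      using alt_rs_4(3) [of "j + n"] j by (simp add: algebra_simps)
  qed
qed

lemma window_sum_parity: "even (window_sum i n) \<longleftrightarrow> even n"
proof (induction n)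
  case (Suc n)
  then show ?case
    using window_sum_Suc_right [of i n] rudin_shapiro_cases [of "i + n"] by auto
qed (simp add: window_sum_0)

text \<open>Maximal sums of consecutive lengths differ by at most one letter, and parity excludes equality.\<close>

lemma extremal_Suc:
  assumes "extremal n s" "extremal (n + 1) t"
  shows "t = s + 1 \<or> t = s - 1"
proof -
  obtain i where i: "window_sum i n = s"
    using assms(1) by (blast elim: extremalE)
  obtain j where j: "window_sum j (n + 1) = t"
    using assms(2) by (blast elim: extremalE)
  have "s - 1 \<le> t"
    using window_sum_Suc_right [of i n] rudin_shapiro_cases [of "i + n"]
      extremal_le [OF assms(2), of i] i by linarith
  moreover have "t \<le> s + 1"
    using window_sum_Suc_right [of j n] rudin_shapiro_cases [of "j + n"]
      extremal_le [OF assms(1), of j] j by linarith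
  moreover have "even s \<longleftrightarrow> odd t"
    using window_sum_parity [of i n] window_sum_parity [of j "n + 1"] i j by simp
  then have "t \<noteq> s" by auto
  ultimately show ?thesis by linarith
qed

lemma extremal_1: "extremal 1 1"
  unfolding extremal_def
proof (intro conjI exI)
  have *: "window_sum i 1 = r i" for i
    using window_sum_Suc_right [of i 0] by (simp add: window_sum_0)
  show "\<forall>i. window_sum i 1 \<le> 1"
  proof
    fix i show "window_sum i 1 \<le> 1"
      using rudin_shapiro_cases [of i] * [of i] by linarith
  qed
  \<comment> \<open>The one-letter window at position 2; the companion starts with 1, -1, 1.\<close>
  show "window_sum (1 + 1) 1 = 1" "alt_rs 1 = -1" "alt_rs (1 + 1) = 1"
    using rudin_shapiro_4 [of 0] alt_rs_4 [of 0] *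
    by (simp_all add: rudin_shapiro_0 alt_rs_def numeral_2_eq_2)
qed

text \<open>The lengths 2 and 3 come from \<open>n = 0\<close> in the steps that use only \<open>n + 1\<close>; the length 1 is the only
base case, as no window of length 0 can carry two different signs at the same position.\<close>

lemma extremal_exists:
  assumes "n > 0"
  shows "\<exists>s. extremal n s"
  using assms
proof (induction n rule: less_induct)
  case (less n)
  show ?case
  proof (cases n rule: residue_mod_4_cases)
    case (1 m)
    with less.prems less.IH [of m] show ?thesis by (auto intro: extremal_4)
  next
    case (2 m)
    show ?thesis
    proof (cases "m = 0")
      case True
      then show ?thesis using extremal_1 2 by auto
    next
      case False
      then obtain s where "extremal m s" using less.IH [of m] 2 by auto
      with 2 show ?thesis by (auto intro: extremal_4_1 simp del: One_nat_def)
    qed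
  next
    case (3 m)
    obtain t where t: "extremal (m + 1) t" using less.IH [of "m + 1"] 3 by auto
    show ?thesis
    proof (cases "m = 0")
      case True
      then show ?thesis
        using extremal_4_2_ascent [of 0 1] extremal_1 3 by (auto simp: window_sum_0)
    next
      case False
      obtain s where s: "extremal m s" using less.IH [of m] 3 False by auto
      from extremal_Suc [OF s t] show ?thesis
      proof
        assume "t = s + 1"
        then have "extremal (4 * m + 2) (2 * t)"
          using s t by (intro extremal_4_2_ascent) (auto simp: extremal_le)
        then show ?thesis using 3 by blast
      next
        assume "t = s - 1"
        then have "extremal (4 * m + 2) (2 * s)"
          using s extremal_le [OF t] by (intro extremal_4_2_descent) auto
        then show ?thesis using 3 by blast
      qed
    qed
  next
    case (4 m)
    then obtain t where "extremal (m + 1) t" using less.IH [of "m + 1"] by auto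
    then show ?thesis using extremal_4_3 4 by blast
  qed
qed


section \<open>Abelian complexity\<close>

lemma card_quotient_kernel:
  "card (A // {(u, v). u \<in> A \<and> v \<in> A \<and> f u = f v}) = card (f ` A)"
proof -
  have "bij_betw (\<lambda>y. {u \<in> A. f u = y}) (f ` A) (A // {(u, v). u \<in> A \<and> v \<in> A \<and> f u = f v})"
  proof (rule bij_betw_imageI)
    show "inj_on (\<lambda>y. {u \<in> A. f u = y}) (f ` A)"
      by (rule inj_onI) blast
    show "(\<lambda>y. {u \<in> A. f u = y}) ` f ` A = A // {(u, v). u \<in> A \<and> v \<in> A \<and> f u = f v}"
    proof -
      have "{(u, v). u \<in> A \<and> v \<in> A \<and> f u = f v} `` {x} = {u \<in> A. f u = f x}" if "x \<in> A" for x
        using that by auto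
      then show ?thesis
        unfolding quotient_def by (simp add: image_image UNION_singleton_eq_range)
    qed
  qed
  then show ?thesis
    by (simp add: bij_betw_same_card)
qed

lemma sum_list_window: "sum_list (map r [i..<i + n]) = window_sum i n"
proof (induction n)
  case (Suc n)
  then show ?case
    using window_sum_Suc_right [of i n] by simp
qed (simp add: window_sum_0)

lemma count_list_sign_word:
  assumes "set u \<subseteq> {1, -1 :: int}"
  shows "2 * int (count_list u 1) = int (length u) + sum_list u"
    and "2 * int (count_list u (-1)) = int (length u) - sum_list u"
  using assms by (induction u) auto

text \<open>For a word of given length over two letters \<open>1\<close> and \<open>-1\<close>, the sum determines both letter counts.\<close>

lemma ab_equiv_sign_words:
  assumes "set u \<subseteq> {1, -1 :: int}" "set v \<subseteq> {1, -1}" "length u = length v"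
  shows "ab_equiv u v \<longleftrightarrow> sum_list u = sum_list v"
proof
  assume "ab_equiv u v"
  then show "sum_list u = sum_list v"
    using count_list_sign_word(1) [OF assms(1)] count_list_sign_word(1) [OF assms(2)] assms(3)
    by (simp add: ab_equiv_def)
next
  assume sum: "sum_list u = sum_list v"
  have "count_list u a = count_list v a" for a
  proof (cases "a \<in> {1, -1}")
    case True
    then show ?thesis
      using count_list_sign_word [OF assms(1)] count_list_sign_word [OF assms(2)] assms(3) sum
      by auto
  next
    case False
    then show ?thesis
      using assms(1,2) by (metis count_notin subsetD)
  qed
  then show "ab_equiv u v"
    by (simp add: ab_equiv_def)
qed

lemma abelian_complexity_eq_card_window_sums:
  "abelian_complexity r n = card (range (\<lambda>i. window_sum i n))"
proof -
  have "{(u, v). u \<in> factors r n \<and> v \<in> factors r n \<and> ab_equiv u v} =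
      {(u, v). u \<in> factors r n \<and> v \<in> factors r n \<and> sum_list u = sum_list v}"
  proof -
    have "set u \<subseteq> {1, -1} \<and> length u = n" if "u \<in> factors r n" for u
      using that unfolding factors_def
      by clarsimp (use rudin_shapiro_cases in blast)
    then show ?thesis
      using ab_equiv_sign_words by blast
  qed
  moreover have "sum_list ` factors r n = range (\<lambda>i. window_sum i n)"
    by (auto simp: factors_def image_def simp flip: sum_list_window)
  ultimately show ?thesis
    by (simp add: abelian_complexity_def card_quotient_kernel)
qed

text \<open>The sign \<open>r n\<close> is the parity of the number of occurrences of \<open>11\<close> in the binary expansion of \<open>n\<close>.
Prefixing the digits \<open>110\<close> adds exactly one occurrence, so the factors are closed under negation,
and the smallest window sum is the negative of the largest.\<close>

lemma rudin_shapiro_negated_copy: "i < 2 ^ k \<Longrightarrow> r (3 * 2 ^ (k + 1) + i) = - r i"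
proof (induction k arbitrary: i)
  case 0
  have "r 6 = -1"
    using rudin_shapiro_4(3) [of 1] rudin_shapiro_4(2) [of 0]
    by (simp add: rudin_shapiro_0 alt_rs_def)
  then show ?case
    using 0 by (simp add: rudin_shapiro_0)
next
  case (Suc k)
  define j where "j = i div 2"
  have IH: "r (3 * 2 ^ (k + 1) + j) = - r j"
    using Suc.prems by (intro Suc.IH) (auto simp: j_def)
  show ?case
  proof (cases "even i")
    case True
    then have i: "i = 2 * j" by (simp add: j_def)
    show ?thesis
      using rudin_shapiro_even [of "3 * 2 ^ (k + 1) + j"] rudin_shapiro_even [of j] IH
      by (simp add: i algebra_simps)
  next
    case False
    then have i: "i = 2 * j + 1" by (simp add: j_def)
    have "r (2 * (3 * 2 ^ (k + 1) + j) + 1) = (-1) ^ (3 * 2 ^ (k + 1) + j) * - r j"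
      by (subst rudin_shapiro_odd) (simp only: IH)
    also have "\<dots> = - r i"
      unfolding i rudin_shapiro_odd by (simp add: power_add)
    finally show ?thesis
      by (simp add: i algebra_simps)
  qed
qed

lemma window_sum_eq_sum: "window_sum i n = (\<Sum>k<n. r (i + k))"
proof (induction n)
  case (Suc n)
  then show ?case
    using window_sum_Suc_right [of i n] by simp
qed (simp add: window_sum_0)

lemma window_sum_negated_copy: "\<exists>j. window_sum j n = - window_sum i n"
proof
  have "r (3 * 2 ^ (i + n + 1) + i + k) = - r (i + k)" if "k < n" for k
  proof -
    have "i + k < 2 ^ (i + n)"
      using that less_exp [of "i + n"] by linarith
    then show ?thesis
      using rudin_shapiro_negated_copy [of "i + k" "i + n"] by (simp add: add.assoc)
  qed
  then show "window_sum (3 * 2 ^ (i + n + 1) + i) n = - window_sum i n"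
    by (simp add: window_sum_eq_sum sum_negf)
qed

text \<open>The places \<open>a\<close> and \<open>b\<close> may come in either order: it is not known whether a minimal window
occurs before or after a maximal one.\<close>

lemma range_intermediate:
  fixes g :: "nat \<Rightarrow> int"
  assumes step: "\<And>i. \<bar>g (Suc i) - g i\<bar> \<le> 1" and "g a \<le> v" "v \<le> g b"
  shows "v \<in> range g"
proof (cases "a \<le> b")
  case True
  then show ?thesis
    using nat_intermed_int_val [of a b g v] assms by auto
next
  case False
  then have "\<exists>i. b \<le> i \<and> i \<le> a \<and> - g i = - v"
    using assms by (intro nat_intermed_int_val) (auto simp: abs_minus_commute)
  then show ?thesis by auto
qed

text \<open>Moving a window by one position changes its sum by \<open>-2\<close>, \<open>0\<close> or \<open>2\<close>, so every value of the right
parity between \<open>-s\<close> and \<open>s\<close> is attained; there are \<open>s + 1\<close> of them.\<close>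

lemma abelian_complexity_extremal:
  assumes "extremal n s"
  shows "int (abelian_complexity r n) = s + 1"
proof -
  obtain a where a: "window_sum a n = s"
    using assms by (blast elim: extremalE)
  obtain b where b: "window_sum b n = - s"
    using window_sum_negated_copy [of n a] a by auto
  have ge: "- s \<le> window_sum i n" for i
    using window_sum_negated_copy [of n i] extremal_le [OF assms] by (metis minus_le_iff)
  have le: "window_sum i n \<le> s" for i
    using extremal_le [OF assms] .
  define g where "g i = (window_sum i n + s) div 2" for i
  have "even (window_sum i n + s)" for i
    using window_sum_parity [of i n] window_sum_parity [of a n] a by simp
  then have g: "window_sum i n = 2 * g i - s" for i
    by (simp add: g_def)
  have step: "\<bar>g (Suc i) - g i\<bar> \<le> 1" for i
  proof -
    have "window_sum (i + 1) n - window_sum i n = r (i + n) - r i"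
      using window_sum_Suc_right [of i n] window_sum_Suc_left [of i n] by simp
    then show ?thesis
      using g [of i] g [of "i + 1"] rudin_shapiro_cases [of i] rudin_shapiro_cases [of "i + n"]
      by auto
  qed
  have "range g = {0..s}"
  proof
    show "range g \<subseteq> {0..s}"
    proof clarify
      fix i show "g i \<in> {0..s}"
        using g [of i] ge [of i] le [of i] by auto
    qed
    show "{0..s} \<subseteq> range g"
    proof
      fix v assume "v \<in> {0..s}"
      moreover have "g a = s" "g b = 0"
        using g [of a] g [of b] a b by auto
      ultimately show "v \<in> range g"
        using range_intermediate [of g b v a] step by auto
    qed
  qed
  moreover have "range (\<lambda>i. window_sum i n) = (\<lambda>k. 2 * k - s) ` range g"
    using g by auto
  moreover have "card ((\<lambda>k. 2 * k - s) ` range g) = card (range g)"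
    by (rule card_image) (auto intro: inj_onI)
  moreover have "0 \<le> s"
    using ge [of a] a by linarith
  ultimately show ?thesis
    by (simp add: abelian_complexity_eq_card_window_sums)
qed

abbreviation rs_complexity :: "nat \<Rightarrow> real" where
  "rs_complexity n \<equiv> real (abelian_complexity rudin_shapiro n)"

lemma abelian_complexity_0: "abelian_complexity rudin_shapiro 0 = 1"
  by (simp add: abelian_complexity_eq_card_window_sums window_sum_0)

lemma abelian_complexity_4:
  assumes "n > 0"
  shows "rs_complexity (4 * n) = 2 * rs_complexity n + 1"
proof -
  obtain s where s: "extremal n s"
    using extremal_exists [OF assms] by blast
  then have "int (abelian_complexity r (4 * n)) = 2 * int (abelian_complexity r n) + 1"
    using abelian_complexity_extremal [OF s] abelian_complexity_extremal [OF extremal_4 [OF s]] by simp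
  then show ?thesis by linarith
qed

lemma abelian_complexity_Suc: "\<bar>rs_complexity (Suc n) - rs_complexity n\<bar> = 1"
proof (cases "n = 0")
  case True
  have "int (abelian_complexity r 1) = 2"
    using abelian_complexity_extremal [OF extremal_1] by simp
  then show ?thesis
    using True by (simp add: abelian_complexity_0)
next
  case False
  then obtain s t where st: "extremal n s" "extremal (n + 1) t"
    using extremal_exists [of n] extremal_exists [of "n + 1"] by auto
  have "int (abelian_complexity r n) = s + 1" "int (abelian_complexity r (Suc n)) = t + 1"
    using abelian_complexity_extremal st by auto
  then show ?thesis
    using extremal_Suc [OF st] by linarith
qed


section \<open>The limit function and its modulus of continuity\<close>

lemma abelian_complexity_add: "\<bar>rs_complexity (n + d) - rs_complexity n\<bar> \<le> real d"
proof (induction d)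
  case (Suc d)
  then show ?case
    using abelian_complexity_Suc [of "n + d"] by simp
qed simp

lemma abelian_complexity_le: "rs_complexity n \<le> real n + 1"
  using abelian_complexity_add [of 0 n] by (simp add: abelian_complexity_0)

lemma rho_nonneg: "0 \<le> rho x"
  by (simp add: rho_def)

lemma rho_le: "0 \<le> x \<Longrightarrow> rho x \<le> x + 1"
  unfolding rho_def by (rule order.trans [OF abelian_complexity_le]) simp

text \<open>The two arguments \<open>\<lfloor>4 x\<rfloor>\<close> and \<open>4 \<lfloor>x\<rfloor>\<close> differ by at most 3, each unit costing 1, and the remaining 1
is the additive constant of the recurrence. At \<open>\<lfloor>x\<rfloor> = 0\<close> the exact recurrence fails, but
\<open>\<rho> 0 - 2 \<rho> 0 = -1\<close> has the same size.\<close>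

lemma rho_quadruple:
  assumes "0 \<le> x"
  shows "\<bar>rho (4 * x) - 2 * rho x\<bar> \<le> 4"
proof -
  define n where "n = nat \<lfloor>x\<rfloor>"
  have n: "of_nat n \<le> x" "x < of_nat n + 1"
    using assms by (auto simp: n_def)
  define d where "d = nat \<lfloor>4 * x\<rfloor> - 4 * n"
  have le: "4 * n \<le> nat \<lfloor>4 * x\<rfloor>"
    using n by (simp add: le_nat_floor)
  have "nat \<lfloor>4 * x\<rfloor> < 4 * n + 4"
    using n assms by linarith
  with le have d: "nat \<lfloor>4 * x\<rfloor> = 4 * n + d" "d \<le> 3"
    by (auto simp: d_def)
  have "\<bar>rs_complexity (4 * n) - 2 * rs_complexity n\<bar> \<le> 1"
    using abelian_complexity_4 [of n] by (cases "n = 0") (auto simp: abelian_complexity_0)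
  then show ?thesis
    using abelian_complexity_add [of "4 * n" d] d unfolding rho_def n_def [symmetric] by simp
qed

definition mu_approx :: "nat \<Rightarrow> real \<Rightarrow> real" where
  "mu_approx k x = rho (4 ^ k * x) / 2 ^ k"

text \<open>The function \<open>\<mu> x = \<lambda> x * sqrt x\<close>, which satisfies \<open>\<mu> (4 x) = 2 \<mu> x\<close> and carries the irregularity of \<open>\<lambda>\<close>.\<close>

definition mu :: "real \<Rightarrow> real" where
  "mu x = lim (\<lambda>k. mu_approx k x)"

text \<open>Consecutive approximants differ by at most \<open>4 / 2\<^bsup>k + 1\<^esup>\<close>. Keeping the negative term in the summed
bound is what lets the induction close.\<close>

lemma mu_approx_diff:
  assumes "0 \<le> x"
  shows "\<bar>mu_approx (k + m) x - mu_approx k x\<bar> \<le> 4 / 2 ^ k - 4 / 2 ^ (k + m)"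
proof (induction m)
  case (Suc m)
  have "mu_approx (k + Suc m) x - mu_approx (k + m) x =
      (rho (4 * (4 ^ (k + m) * x)) - 2 * rho (4 ^ (k + m) * x)) / 2 ^ (k + Suc m)"
    by (simp add: mu_approx_def field_simps)
  then have "\<bar>mu_approx (k + Suc m) x - mu_approx (k + m) x\<bar> \<le> 4 / 2 ^ (k + Suc m)"
    using divide_right_mono [OF rho_quadruple [of "4 ^ (k + m) * x"], of "2 ^ (k + Suc m)"] assms
    by (simp add: abs_divide)
  moreover have "4 / 2 ^ (k + m) = 2 * (4 / 2 ^ (k + Suc m) :: real)"
    by simp
  ultimately show ?case
    using Suc by linarith
qed simp

lemma mu_approx_diff_uniform:
  assumes "0 \<le> x"
  shows "\<bar>mu_approx (k + m) x - mu_approx k x\<bar> \<le> 4 / 2 ^ k"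
  using mu_approx_diff [OF assms, of k m] by (rule order.trans) simp

lemma mu_approx_tendsto:
  assumes "0 \<le> x"
  shows "(\<lambda>k. mu_approx k x) \<longlonglongrightarrow> mu x"
proof -
  have "Cauchy (\<lambda>k. mu_approx k x)"
  proof (rule CauchyI')
    fix e :: real assume "0 < e"
    then obtain M where M: "(1/2) ^ M < e / 4"
      using real_arch_pow_inv [of "e / 4" "1/2"] by auto
    show "\<exists>M. \<forall>m\<ge>M. \<forall>n>m. dist (mu_approx m x) (mu_approx n x) < e"
    proof (intro exI allI impI)
      fix m n assume mn: "M \<le> m" "m < n"
      have "dist (mu_approx m x) (mu_approx n x) \<le> 4 / 2 ^ m"
        using mu_approx_diff_uniform [OF assms, of m "n - m"] mn by (simp add: dist_real_def abs_minus_commute)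
      also have "\<dots> \<le> 4 / 2 ^ M"
        using mn by (intro divide_left_mono power_increasing) auto
      also have "\<dots> < e"
        using M by (simp add: power_one_over field_simps)
      finally show "dist (mu_approx m x) (mu_approx n x) < e" .
    qed
  qed
  then show ?thesis
    unfolding mu_def by (simp add: Cauchy_convergent convergent_LIMSEQ_iff [symmetric])
qed

lemma mu_approx_error:
  assumes "0 \<le> x"
  shows "\<bar>mu x - mu_approx k x\<bar> \<le> 4 / 2 ^ k"
proof (rule LIMSEQ_le_const2)
  show "(\<lambda>m. \<bar>mu_approx (m + k) x - mu_approx k x\<bar>) \<longlonglongrightarrow> \<bar>mu x - mu_approx k x\<bar>"
    by (intro tendsto_intros LIMSEQ_ignore_initial_segment mu_approx_tendsto assms)
  show "\<exists>N. \<forall>m\<ge>N. \<bar>mu_approx (m + k) x - mu_approx k x\<bar> \<le> 4 / 2 ^ k"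
    using mu_approx_diff_uniform [OF assms, of k] by (auto simp: add.commute)
qed

lemma lambda_fun_eq:
  assumes "0 < x"
  shows "lambda_fun x = mu x / sqrt x"
proof -
  have "sqrt (4 ^ k * x) = 2 ^ k * sqrt x" for k
    by (simp add: real_sqrt_mult real_sqrt_power)
  then have "(\<lambda>k. rho (4 ^ k * x) / sqrt (4 ^ k * x)) = (\<lambda>k. mu_approx k x / sqrt x)"
    by (simp add: mu_approx_def)
  moreover have "(\<lambda>k. mu_approx k x / sqrt x) \<longlonglongrightarrow> mu x / sqrt x"
    using assms by (intro tendsto_intros mu_approx_tendsto) auto
  ultimately show ?thesis
    unfolding lambda_fun_def by (simp add: limI)
qed

text \<open>The recurrence \<open>\<rho> (4 n) + 1 = 2 (\<rho> n + 1)\<close> is linear in \<open>\<rho> + 1\<close>, so that the limit is explicit at grid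
points. Thus \<open>\<mu>\<close> inherits without error the jumps of size 1 of \<open>\<rho>\<close>.\<close>

lemma mu_grid:
  assumes "n > 0"
  shows "mu (real n / 4 ^ k) = (rs_complexity n + 1) / 2 ^ k"
proof -
  have c: "rs_complexity (4 ^ m * n) = 2 ^ m * (rs_complexity n + 1) - 1" for m
  proof (induction m)
    case (Suc m)
    then show ?case
      using abelian_complexity_4 [of "4 ^ m * n"] assms by (simp add: algebra_simps)
  qed simp
  have "mu_approx (m + k) (real n / 4 ^ k) = (rs_complexity n + 1) / 2 ^ k - (1/2) ^ m / 2 ^ k" for m
  proof -
    have "4 ^ (m + k) * (real n / 4 ^ k) = real (4 ^ m * n)"
      by (simp add: power_add)
    then have "mu_approx (m + k) (real n / 4 ^ k) = rs_complexity (4 ^ m * n) / 2 ^ (m + k)"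
      unfolding mu_approx_def rho_def by (simp only: floor_of_nat nat_int)
    also have "\<dots> = (rs_complexity n + 1) / 2 ^ k - (1/2) ^ m / 2 ^ k"
      unfolding c by (simp add: power_add field_simps)
    finally show ?thesis .
  qed
  moreover have "(\<lambda>m. (rs_complexity n + 1) / 2 ^ k - (1/2) ^ m / 2 ^ k)
      \<longlonglongrightarrow> (rs_complexity n + 1) / 2 ^ k - 0 / 2 ^ k"
    by (intro tendsto_intros LIMSEQ_power_zero) auto
  ultimately have "(\<lambda>m. mu_approx (m + k) (real n / 4 ^ k)) \<longlonglongrightarrow> (rs_complexity n + 1) / 2 ^ k"
    by simp
  moreover have "(\<lambda>m. mu_approx (m + k) (real n / 4 ^ k)) \<longlonglongrightarrow> mu (real n / 4 ^ k)"
    by (intro LIMSEQ_ignore_initial_segment mu_approx_tendsto) simp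
  ultimately show ?thesis
    by (rule LIMSEQ_unique [symmetric])
qed

lemma rho_diff_le_1:
  assumes "0 \<le> x" "x \<le> y" "y \<le> x + 1"
  shows "\<bar>rho x - rho y\<bar> \<le> 1"
proof -
  have "nat \<lfloor>y\<rfloor> = nat \<lfloor>x\<rfloor> \<or> nat \<lfloor>y\<rfloor> = Suc (nat \<lfloor>x\<rfloor>)"
    using assms by linarith
  then show ?thesis
    using abelian_complexity_Suc [of "nat \<lfloor>x\<rfloor>"] by (auto simp: rho_def)
qed

lemma mu_diff_grid_scale:
  assumes "0 \<le> x" "0 \<le> y" "\<bar>x - y\<bar> \<le> 1 / 4 ^ k"
  shows "\<bar>mu x - mu y\<bar> \<le> 9 / 2 ^ k"
  using assms
proof (induction x y rule: linorder_wlog)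
  case (le x y)
  have "\<bar>rho (4 ^ k * x) - rho (4 ^ k * y)\<bar> \<le> 1"
    using le by (intro rho_diff_le_1) (auto simp: field_simps)
  then have "\<bar>mu_approx k x - mu_approx k y\<bar> \<le> 1 / 2 ^ k"
    by (simp add: mu_approx_def abs_divide divide_right_mono flip: diff_divide_distrib)
  moreover have "9 / 2 ^ k = 4 / 2 ^ k + 1 / 2 ^ k + (4 / 2 ^ k :: real)"
    by (simp flip: add_divide_distrib)
  ultimately show ?case
    using mu_approx_error [of x k] mu_approx_error [of y k] le by linarith
qed (simp add: abs_minus_commute)

text \<open>All estimates are made at the scales \<open>1 / 4\<^sup>k\<close>; any other scale is within a factor 4 of one of them.\<close>

lemma grid_scale_exists:
  fixes h :: real
  assumes "0 < h" "h \<le> 1"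
  obtains k where "1 / 4 ^ (k + 1) < h" "h \<le> 1 / 4 ^ k"
proof -
  define n where "n = (LEAST n. 1 / 4 ^ n < h)"
  have ex: "\<exists>n. 1 / 4 ^ n < h"
    using real_arch_pow_inv [of h "1/4"] assms by (auto simp: power_one_over)
  then have n: "1 / 4 ^ n < h"
    unfolding n_def by (rule LeastI_ex)
  with assms have "n \<noteq> 0"
    by (intro notI) simp
  then obtain k where k: "n = k + 1"
    by (metis Suc_eq_plus1 not0_implies_Suc)
  then have "\<not> 1 / 4 ^ k < h"
    using not_less_Least [of k "\<lambda>n. 1 / 4 ^ n < h"] by (simp add: n_def)
  then show ?thesis
    using n k that by auto
qed

lemma sqrt_grid_scale: "sqrt (1 / 4 ^ k) = 1 / 2 ^ k"
  by (simp add: real_sqrt_divide real_sqrt_power)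

lemma mu_Holder:
  assumes "0 \<le> x" "0 \<le> y" "\<bar>x - y\<bar> \<le> h" "0 < h" "h \<le> 1"
  shows "\<bar>mu x - mu y\<bar> \<le> 18 * sqrt h"
proof -
  obtain k where k: "1 / 4 ^ (k + 1) < h" "h \<le> 1 / 4 ^ k"
    using grid_scale_exists [OF assms(4,5)] .
  have "\<bar>mu x - mu y\<bar> \<le> 9 / 2 ^ k"
    using assms k by (intro mu_diff_grid_scale) auto
  also have "\<dots> = 18 * sqrt (1 / 4 ^ (k + 1))"
    by (simp only: sqrt_grid_scale) simp
  also have "\<dots> \<le> 18 * sqrt h"
    using k by (intro mult_left_mono real_sqrt_le_mono) auto
  finally show ?thesis .
qed

text \<open>For \<open>x \<le> 1\<close> the magnification \<open>4\<^sup>k\<close> is chosen such that \<open>4\<^sup>k x\<close> lies between \<open>1/4\<close> and \<open>1\<close>; this makes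
\<open>2\<^sup>k\<close> comparable to \<open>1 / sqrt x\<close> and gives a bound that stays valid down to \<open>0\<close>.\<close>

lemma lambda_fun_bounded:
  assumes "0 < x" "x \<le> b"
  shows "\<bar>lambda_fun x\<bar> \<le> 12 + b"
proof -
  have bound: "\<bar>mu x\<bar> \<le> (5 + 4 ^ k * x) / 2 ^ k" for k
  proof -
    have "\<bar>mu_approx k x\<bar> \<le> (4 ^ k * x + 1) / 2 ^ k"
      using rho_le [of "4 ^ k * x"] rho_nonneg [of "4 ^ k * x"] assms
      by (simp add: mu_approx_def divide_right_mono)
    moreover have "(5 + 4 ^ k * x) / 2 ^ k = 4 / 2 ^ k + (4 ^ k * x + 1) / 2 ^ k"
      by (simp flip: add_divide_distrib)
    ultimately show ?thesis
      using mu_approx_error [of x k] assms by linarith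
  qed
  have "\<bar>mu x\<bar> \<le> (12 + b) * sqrt x"
  proof (cases "x \<le> 1")
    case True
    obtain k where k: "1 / 4 ^ (k + 1) < x" "x \<le> 1 / 4 ^ k"
      using grid_scale_exists [OF assms(1) True] .
    have "\<bar>mu x\<bar> \<le> 6 / 2 ^ k"
      using k by (intro order.trans [OF bound [of k]] divide_right_mono) (auto simp: field_simps)
    also have "\<dots> = 12 * sqrt (1 / 4 ^ (k + 1))"
      by (simp only: sqrt_grid_scale) simp
    also have "\<dots> \<le> 12 * sqrt x"
      using k by (intro mult_left_mono real_sqrt_le_mono) auto
    also have "\<dots> \<le> (12 + b) * sqrt x"
      using assms by (intro mult_right_mono) auto
    finally show ?thesis .
  next
    case False
    then have sqrt: "1 \<le> sqrt x" by simp
    have "\<bar>mu x\<bar> \<le> 5 + b"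
      using bound [of 0] assms by simp
    also have "\<dots> \<le> (12 + b) * 1"
      by simp
    also have "\<dots> \<le> (12 + b) * sqrt x"
      using sqrt assms by (intro mult_left_mono) auto
    finally show ?thesis .
  qed
  then show ?thesis
    using assms by (simp add: lambda_fun_eq abs_divide field_simps)
qed

text \<open>Splits the variation of \<open>\<mu> / sqrt\<close> into that of \<open>\<mu>\<close> and that of the square root. The second part is
expressed by \<open>\<lambda>\<close> itself, whose boundedness then controls it.\<close>

lemma lambda_fun_diff:
  assumes "0 < x" "0 < y"
  shows "lambda_fun x - lambda_fun y =
    (mu x - mu y) / sqrt x + lambda_fun y * (sqrt y - sqrt x) / sqrt x"
  using assms by (simp add: lambda_fun_eq field_simps)

lemma abs_sqrt_diff_le:
  assumes "0 \<le> x" "0 \<le> y"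
  shows "\<bar>sqrt x - sqrt y\<bar> \<le> sqrt \<bar>x - y\<bar>"
  using assms
proof (induction x y rule: linorder_wlog)
  case (le x y)
  then have "sqrt y \<le> sqrt x + sqrt (y - x)"
    using sqrt_add_le_add_sqrt [of x "y - x"] by simp
  with le show ?case by (simp add: abs_real_def)
qed (simp add: abs_minus_commute)

text \<open>The factor \<open>1 / sqrt x\<close> records how the modulus of continuity deteriorates towards \<open>0\<close>; it is kept
explicit so that the mesh columns near \<open>0\<close> can be summed.\<close>

lemma lambda_fun_Holder:
  assumes "0 < x" "x \<le> b" "0 < y" "y \<le> b" "\<bar>x - y\<bar> \<le> h" "0 < h" "h \<le> 1"
  shows "\<bar>lambda_fun x - lambda_fun y\<bar> \<le> (30 + b) * sqrt h / sqrt x"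
proof -
  have "\<bar>sqrt y - sqrt x\<bar> \<le> sqrt \<bar>y - x\<bar>"
    using assms by (intro abs_sqrt_diff_le) auto
  also have "\<dots> \<le> sqrt h"
    using assms by (simp add: abs_minus_commute)
  finally have "\<bar>lambda_fun y * (sqrt y - sqrt x)\<bar> \<le> (12 + b) * sqrt h"
    using assms unfolding abs_mult by (intro mult_mono lambda_fun_bounded) auto
  moreover have "\<bar>mu x - mu y\<bar> \<le> 18 * sqrt h"
    using assms by (intro mu_Holder) auto
  ultimately have "\<bar>(mu x - mu y) + lambda_fun y * (sqrt y - sqrt x)\<bar> \<le> (30 + b) * sqrt h"
    by (simp add: algebra_simps)
  then show ?thesis
    using assms by (simp add: lambda_fun_diff abs_divide divide_right_mono flip: add_divide_distrib)
qed

lemma continuous_on_lambda_fun: "continuous_on {0<..} lambda_fun"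
proof -
  have "continuous_on {0<..} mu"
    unfolding continuous_on_iff
  proof (intro ballI allI impI)
    fix x e :: real assume x: "x \<in> {0<..}" and e: "0 < e"
    define h where "h = min 1 ((e / 19)\<^sup>2)"
    have h: "0 < h" "h \<le> 1" using e by (auto simp: h_def)
    have "sqrt h \<le> sqrt ((e / 19)\<^sup>2)"
      unfolding h_def by (intro real_sqrt_le_mono) simp
    then have "18 * sqrt h < e"
      using e by simp
    then have "\<bar>mu x' - mu x\<bar> < e" if "0 < x'" "\<bar>x' - x\<bar> < h" for x'
      using mu_Holder [of x' x h] that x h by auto
    then show "\<exists>d>0. \<forall>x'\<in>{0<..}. dist x' x < d \<longrightarrow> dist (mu x') (mu x) < e"
      using h by (auto simp: dist_real_def)
  qed
  then have "continuous_on {0<..} (\<lambda>x. mu x / sqrt x)"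
    by (intro continuous_intros) auto
  then show ?thesis
    by (rule continuous_on_eq) (simp add: lambda_fun_eq)
qed

text \<open>Between neighbouring grid points \<open>\<mu>\<close> jumps by \<open>1 / 2\<^sup>k\<close>, while the square root moves only by
\<open>O (1 / 4\<^sup>k)\<close>. The hypothesis on \<open>k\<close> says that the scale is fine enough for the second contribution to
cancel at most half of the first.\<close>

lemma lambda_fun_grid_oscillation:
  fixes n k :: nat and a b :: real
  defines "x \<equiv> real n / 4 ^ k" and "y \<equiv> real (n + 1) / 4 ^ k"
  assumes "0 < a" "a \<le> x" "y \<le> b"
    and k: "(12 + b) / a / 2 ^ k \<le> 1 / (2 * sqrt b)"
  shows "1 / (2 * sqrt b) / 2 ^ k \<le> \<bar>lambda_fun y - lambda_fun x\<bar>"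
proof -
  have yx: "y - x = 1 / 4 ^ k"
    by (simp add: x_def y_def flip: diff_divide_distrib)
  have pos: "0 < x" "x < y" "0 < y" "0 < b"
  proof -
    show "0 < x" using assms(3,4) by linarith
    show "x < y" using yx by (metis diff_gt_0_iff_gt zero_less_divide_1_iff zero_less_numeral zero_less_power)
    then show "0 < y" "0 < b" using \<open>0 < x\<close> assms(5) by linarith+
  qed
  have "n > 0"
    using pos(1) unfolding x_def by (cases n) auto
  then have "mu y - mu x = (rs_complexity (Suc n) - rs_complexity n) / 2 ^ k"
    using mu_grid [of n k] mu_grid [of "n + 1" k] unfolding x_def y_def
    by (simp add: diff_divide_distrib add_divide_distrib)
  then have mu: "\<bar>mu y - mu x\<bar> = 1 / 2 ^ k"
    using abelian_complexity_Suc [of n] by (simp add: abs_divide)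
  have "1 / sqrt b / 2 ^ k \<le> \<bar>(mu y - mu x) / sqrt y\<bar>"
    using pos assms(5) by (simp add: abs_divide mu frac_le)
  moreover have "\<bar>lambda_fun x * (sqrt x - sqrt y) / sqrt y\<bar> \<le> 1 / (2 * sqrt b) / 2 ^ k"
  proof -
    have "(sqrt y - sqrt x) * (sqrt y + sqrt x) = 1 / 4 ^ k"
      using pos yx by (simp add: algebra_simps)
    moreover have "sqrt y + sqrt x \<noteq> 0"
      using pos by (metis add_pos_pos less_irrefl real_sqrt_gt_zero)
    ultimately have "sqrt y - sqrt x = (1 / 4 ^ k) / (sqrt y + sqrt x)"
      by (metis nonzero_eq_divide_eq)
    then have "(sqrt y - sqrt x) / sqrt y = (1 / 4 ^ k) / (sqrt y * (sqrt y + sqrt x))"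
      by (simp add: mult.commute)
    also have "\<dots> \<le> (1 / 4 ^ k) / a"
    proof -
      have "a \<le> y" "0 \<le> sqrt y * sqrt x"
        using pos assms(4) by auto
      moreover have "sqrt y * (sqrt y + sqrt x) = y + sqrt y * sqrt x"
        using pos by (simp add: distrib_left)
      ultimately have "a \<le> sqrt y * (sqrt y + sqrt x)"
        by linarith
      moreover from this have "0 < sqrt y * (sqrt y + sqrt x) * a"
        using assms(3) by (meson less_le_trans mult_pos_pos)
      ultimately show ?thesis
        by (intro divide_left_mono) auto
    qed
    finally have q: "(sqrt y - sqrt x) / sqrt y \<le> (1 / 4 ^ k) / a" .
    have "\<bar>lambda_fun x * (sqrt x - sqrt y) / sqrt y\<bar> = \<bar>lambda_fun x\<bar> * ((sqrt y - sqrt x) / sqrt y)"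
      using pos by (simp add: abs_mult abs_divide)
    also have "\<dots> \<le> (12 + b) * ((1 / 4 ^ k) / a)"
      using pos assms by (intro mult_mono q lambda_fun_bounded) auto
    also have "\<dots> = (12 + b) / a / 2 ^ k / 2 ^ k"
      by (simp add: field_simps flip: power_mult_distrib)
    also have "\<dots> \<le> 1 / (2 * sqrt b) / 2 ^ k"
      using k by (rule divide_right_mono) simp
    finally show ?thesis .
  qed
  moreover have "1 / sqrt b / 2 ^ k = 1 / (2 * sqrt b) / 2 ^ k + 1 / (2 * sqrt b) / 2 ^ k"
    by simp
  ultimately show ?thesis
    using lambda_fun_diff [of y x] pos by linarith
qed


section \<open>Counting mesh squares\<close>

definition mesh_square :: "real \<Rightarrow> int \<Rightarrow> int \<Rightarrow> (real \<times> real) set" where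
  "mesh_square \<delta> m1 m2 = {of_int m1 * \<delta>..(of_int m1 + 1) * \<delta>} \<times> {of_int m2 * \<delta>..(of_int m2 + 1) * \<delta>}"

text \<open>Mesh squares are counted column by column; the squares of column \<open>m1\<close> meeting \<open>F\<close> are represented by
their row numbers.\<close>

definition hit_rows :: "real \<Rightarrow> (real \<times> real) set \<Rightarrow> int \<Rightarrow> int set" where
  "hit_rows \<delta> F m1 = {m2. mesh_square \<delta> m1 m2 \<inter> F \<noteq> {}}"

lemma mesh_count_eq:
  assumes "0 < \<delta>"
  shows "mesh_count \<delta> F = card (SIGMA m1:UNIV. hit_rows \<delta> F m1)"
proof -
  have "inj (\<lambda>(m1, m2). mesh_square \<delta> m1 m2)"
  proof (rule injI, clarify)
    fix a b c d assume "mesh_square \<delta> a b = mesh_square \<delta> c d"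
    then show "a = c \<and> b = d"
      using assms by (auto simp: mesh_square_def times_eq_iff Icc_eq_Icc)
  qed
  then have "inj_on (\<lambda>(m1, m2). mesh_square \<delta> m1 m2) (SIGMA m1:UNIV. hit_rows \<delta> F m1)"
    by (rule inj_on_subset) simp
  moreover have "{Q \<in> mesh_squares \<delta>. Q \<inter> F \<noteq> {}} =
      (\<lambda>(m1, m2). mesh_square \<delta> m1 m2) ` (SIGMA m1:UNIV. hit_rows \<delta> F m1)"
    by (auto simp: mesh_squares_def mesh_square_def hit_rows_def)
  ultimately show ?thesis
    by (simp add: mesh_count_def card_image)
qed

lemma hit_rows_graph_iff:
  "m2 \<in> hit_rows \<delta> {(x, f x) | x. x \<in> I} m1 \<longleftrightarrow>
    (\<exists>x\<in>I. of_int m1 * \<delta> \<le> x \<and> x \<le> (of_int m1 + 1) * \<delta> \<and>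
      of_int m2 * \<delta> \<le> f x \<and> f x \<le> (of_int m2 + 1) * \<delta>)"
  by (auto simp: hit_rows_def mesh_square_def disjoint_iff)

lemma card_rows_le:
  fixes Z :: "int set"
  assumes "0 < \<delta>" "0 \<le> D"
    and Z: "\<And>z. z \<in> Z \<Longrightarrow> \<exists>v. \<bar>v - v0\<bar> \<le> D \<and> of_int z * \<delta> \<le> v \<and> v \<le> (of_int z + 1) * \<delta>"
  shows "finite Z" and "real (card Z) \<le> 2 * D / \<delta> + 2"
proof -
  let ?J = "{\<lceil>(v0 - D) / \<delta> - 1\<rceil>..\<lfloor>(v0 + D) / \<delta>\<rfloor>}"
  have sub: "Z \<subseteq> ?J"
  proof
    fix z assume "z \<in> Z"
    then obtain v where "\<bar>v - v0\<bar> \<le> D" "of_int z * \<delta> \<le> v" "v \<le> (of_int z + 1) * \<delta>"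
      using Z by blast
    then have "of_int z * \<delta> \<le> v0 + D" "v0 - D \<le> (of_int z + 1) * \<delta>"
      by linarith+
    then have "of_int z \<le> (v0 + D) / \<delta>" "(v0 - D) / \<delta> \<le> of_int z + 1"
      using assms(1) by (simp_all add: field_simps)
    then have "(v0 - D) / \<delta> - 1 \<le> of_int z" "of_int z \<le> (v0 + D) / \<delta>"
      by linarith+
    then show "z \<in> ?J"
      by (simp only: le_floor_iff ceiling_le_iff atLeastAtMost_iff simp_thms)
  qed
  then show "finite Z"
    by (rule finite_subset) simp
  have "card Z \<le> card ?J"
    using sub by (rule card_mono [rotated]) simp
  moreover have "real (card ?J) \<le> max 0 ((v0 + D) / \<delta> - ((v0 - D) / \<delta> - 1) + 1)"
    unfolding card_atLeastAtMost_int by linarith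
  moreover have "(v0 + D) / \<delta> - ((v0 - D) / \<delta> - 1) + 1 = 2 * D / \<delta> + 2"
    by (simp add: add_divide_distrib diff_divide_distrib)
  moreover have "0 \<le> 2 * D / \<delta> + 2"
    using assms by simp
  ultimately show "real (card Z) \<le> 2 * D / \<delta> + 2"
    by linarith
qed

lemma sum_inverse_sqrt_le: "(\<Sum>m = 1..M. 1 / sqrt (real m)) \<le> 2 * sqrt (real M)"
proof (induction M)
  case (Suc M)
  have "1 / sqrt (real (Suc M)) \<le> 2 * (sqrt (real (Suc M)) - sqrt (real M))"
  proof -
    \<comment> \<open>Expanding the square gives \<open>2 sqrt M sqrt (M + 1) \<le> 2 M + 1\<close>.\<close>
    have "(sqrt (real (Suc M)) - sqrt (real M))\<^sup>2 \<ge> 0" by simp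
    then have "1 \<le> 2 * (sqrt (real (Suc M)) - sqrt (real M)) * sqrt (real (Suc M))"
      by (simp add: power2_eq_square algebra_simps)
    then show ?thesis
      by (simp add: divide_le_eq)
  qed
  then show ?case
    using Suc by simp
qed simp

lemma three_halves_scale:
  fixes \<delta> :: real
  assumes "0 < \<delta>" "\<delta> \<le> 1"
  shows "1 \<le> 1 / (\<delta> * sqrt \<delta>)" "1 / \<delta> \<le> 1 / (\<delta> * sqrt \<delta>)"
  using assms by (auto simp: mult_le_one divide_simps)

text \<open>Column \<open>0\<close> is controlled by the bound on \<open>f\<close> only. For \<open>m \<ge> 1\<close> the points of column \<open>m\<close> satisfy
\<open>x \<ge> m \<delta>\<close>, so that the oscillation \<open>C sqrt \<delta> / sqrt x\<close> is at most \<open>C / sqrt m\<close>. Summing over the at most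
\<open>b / \<delta>\<close> such columns gives \<open>O (sqrt (b / \<delta>) / \<delta>)\<close> squares, next to which the \<open>O (1 / \<delta>)\<close> squares of
column \<open>0\<close> and of the rounding at the column ends are negligible.\<close>

lemma mesh_count_graph_upper:
  fixes f :: "real \<Rightarrow> real"
  assumes I: "I \<subseteq> {0<..b}" and b: "0 < b" and nonneg: "0 \<le> B" "0 \<le> C"
    and bound: "\<And>x. x \<in> I \<Longrightarrow> \<bar>f x\<bar> \<le> B"
    and Holder: "\<And>x y h. \<lbrakk>x \<in> I; y \<in> I; \<bar>x - y\<bar> \<le> h; 0 < h; h \<le> 1\<rbrakk> \<Longrightarrow>
      \<bar>f x - f y\<bar> \<le> C * sqrt h / sqrt x"
    and \<delta>: "0 < \<delta>" "\<delta> \<le> 1"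
  defines "F \<equiv> {(x, f x) | x. x \<in> I}"
  shows "finite (SIGMA m1:UNIV. hit_rows \<delta> F m1)"
    and "real (mesh_count \<delta> F) \<le> (2 * B + 2 + 4 * C * sqrt b + 2 * b) / (\<delta> * sqrt \<delta>)"
proof -
  define M where "M = nat \<lfloor>b / \<delta>\<rfloor>"
  have M: "real M \<le> b / \<delta>"
    using b \<delta> by (simp add: M_def)
  define N where "N m = card (hit_rows \<delta> F (int m))" for m
  have columns: "m \<in> int ` {0..M}" if hit: "m2 \<in> hit_rows \<delta> F m" for m m2
  proof -
    obtain x where x: "x \<in> I" "of_int m * \<delta> \<le> x" "x \<le> (of_int m + 1) * \<delta>"
      using hit unfolding F_def hit_rows_graph_iff by blast
    then have "0 < x" "x \<le> b" using I by auto
    with x have "0 < (of_int m + 1) * \<delta>" "of_int m * \<delta> \<le> b"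
      by linarith+
    then have "0 < real_of_int (m + 1)" "of_int m \<le> b / \<delta>"
      using \<delta> by (simp_all add: zero_less_mult_iff pos_le_divide_eq)
    then have "0 \<le> m" "m \<le> \<lfloor>b / \<delta>\<rfloor>"
      unfolding of_int_0_less_iff by (simp_all add: le_floor_iff)
    then show ?thesis
      by (intro image_eqI [of _ _ "nat m"]) (auto simp: M_def nat_mono)
  qed
  have row0: "finite (hit_rows \<delta> F 0)" "real (N 0) \<le> 2 * B / \<delta> + 2"
  proof -
    have "\<exists>v. \<bar>v - 0\<bar> \<le> B \<and> of_int z * \<delta> \<le> v \<and> v \<le> (of_int z + 1) * \<delta>" 
      if "z \<in> hit_rows \<delta> F 0" for z
      using that bound unfolding F_def hit_rows_graph_iff by fastforce
    note * = card_rows_le [of \<delta> B "hit_rows \<delta> F 0" 0, OF \<delta>(1) nonneg(1) this]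
    show "finite (hit_rows \<delta> F 0)" by (rule *)
    show "real (N 0) \<le> 2 * B / \<delta> + 2" unfolding N_def using *(2) by simp
  qed
  have row: "finite (hit_rows \<delta> F (int m)) \<and> real (N m) \<le> 2 * C / \<delta> * (1 / sqrt m) + 2"
    if m: "1 \<le> m" for m
  proof (cases "\<exists>x. x \<in> I \<and> real m * \<delta> \<le> x \<and> x \<le> (real m + 1) * \<delta>")
    case False
    then have "hit_rows \<delta> F (int m) = {}"
      unfolding F_def using hit_rows_graph_iff [of _ \<delta> f I "int m"] by auto
    then show ?thesis
      using nonneg \<delta> by (simp add: N_def)
  next
    case True
    then obtain x where x: "x \<in> I" "real m * \<delta> \<le> x" "x \<le> (real m + 1) * \<delta>" by blast
    have "\<bar>f y - f x\<bar> \<le> C / sqrt m" if y: "y \<in> I" "real m * \<delta> \<le> y" "y \<le> (real m + 1) * \<delta>" for y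
    proof -
      have "(real m + 1) * \<delta> = real m * \<delta> + \<delta>"
        by (simp add: algebra_simps)
      then have "\<bar>y - x\<bar> \<le> \<delta>"
        using x y by linarith
      then have "\<bar>f y - f x\<bar> \<le> C * sqrt \<delta> / sqrt y"
        using Holder x y \<delta> by blast
      also have "\<dots> \<le> C * sqrt \<delta> / sqrt (real m * \<delta>)"
        using y m \<delta> nonneg I by (intro divide_left_mono real_sqrt_le_mono) (auto intro!: mult_pos_pos)
      also have "\<dots> = C / sqrt m"
        using \<delta> by (simp add: real_sqrt_mult)
      finally show ?thesis .
    qed
    then have "\<exists>v. \<bar>v - f x\<bar> \<le> C / sqrt m \<and> of_int z * \<delta> \<le> v \<and> v \<le> (of_int z + 1) * \<delta>"
      if "z \<in> hit_rows \<delta> F (int m)" for z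
      using that unfolding F_def hit_rows_graph_iff by auto
    then show ?thesis
      using card_rows_le [of \<delta> "C / sqrt m" "hit_rows \<delta> F (int m)" "f x"] \<delta>(1) nonneg(2) m
      by (simp add: N_def mult.commute)
  qed
  have finite_row: "finite (hit_rows \<delta> F (int m))" for m
    using row0 row [of m] by (cases "m = 0") auto
  have sigma: "(SIGMA m1:UNIV. hit_rows \<delta> F m1) = (SIGMA m1:int ` {0..M}. hit_rows \<delta> F m1)"
    using columns by blast
  show "finite (SIGMA m1:UNIV. hit_rows \<delta> F m1)"
    unfolding sigma using finite_row by (intro finite_SigmaI) auto
  have "mesh_count \<delta> F = (\<Sum>m1\<in>int ` {0..M}. card (hit_rows \<delta> F m1))"
    unfolding mesh_count_eq [OF \<delta>(1)] sigma using finite_row by (intro card_SigmaI) auto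
  also have "\<dots> = (\<Sum>m\<in>{0..M}. N m)"
    unfolding N_def by (subst sum.reindex) (auto simp: inj_on_def)
  finally have "real (mesh_count \<delta> F) = (\<Sum>m\<in>{0..M}. real (N m))"
    by simp
  also have "\<dots> = real (N 0) + (\<Sum>m = 1..M. real (N m))"
    by (simp add: sum.atLeast_Suc_atMost)
  also have "\<dots> \<le> (2 * B / \<delta> + 2) + (\<Sum>m = 1..M. 2 * C / \<delta> * (1 / sqrt m) + 2)"
    using row by (intro add_mono row0 sum_mono) auto
  also have "\<dots> = 2 * B / \<delta> + 2 + 2 * C / \<delta> * (\<Sum>m = 1..M. 1 / sqrt m) + 2 * real M"
    by (simp add: sum.distrib sum_distrib_left)
  also have "\<dots> \<le> 2 * B / \<delta> + 2 + 2 * C / \<delta> * (2 * sqrt (b / \<delta>)) + 2 * (b / \<delta>)"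
  proof -
    have "sqrt (real M) \<le> sqrt (b / \<delta>)" using M by simp
    then have "(\<Sum>m = 1..M. 1 / sqrt m) \<le> 2 * sqrt (b / \<delta>)"
      using sum_inverse_sqrt_le [of M] by linarith
    then show ?thesis
      using M nonneg \<delta> by (intro add_mono mult_left_mono) auto
  qed
  also have "\<dots> = 2 * B * (1 / \<delta>) + 2 * 1 + 4 * C * sqrt b * (1 / (\<delta> * sqrt \<delta>)) + 2 * b * (1 / \<delta>)"
    by (simp add: real_sqrt_divide)
  also have "\<dots> \<le> 2 * B * (1 / (\<delta> * sqrt \<delta>)) + 2 * (1 / (\<delta> * sqrt \<delta>)) +
      4 * C * sqrt b * (1 / (\<delta> * sqrt \<delta>)) + 2 * b * (1 / (\<delta> * sqrt \<delta>))"
    using three_halves_scale [OF \<delta>] nonneg b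
    by (intro add_mono mult_left_mono) auto
  also have "\<dots> = (2 * B + 2 + 4 * C * sqrt b + 2 * b) / (\<delta> * sqrt \<delta>)"
    by (simp add: add_divide_distrib)
  finally show "real (mesh_count \<delta> F) \<le> (2 * B + 2 + 4 * C * sqrt b + 2 * b) / (\<delta> * sqrt \<delta>)" .
qed

text \<open>By continuity the graph meets every row between the two values given by the oscillation hypothesis,
so that each of the about \<open>(b - a) / \<delta>\<close> columns inside \<open>[a, b]\<close> contributes about \<open>D sqrt \<delta> / \<delta>\<close>
squares. Smallness of \<open>\<delta>\<close> absorbs the rounding losses into factors 2.\<close>

lemma mesh_count_graph_lower:
  fixes f :: "real \<Rightarrow> real"
  assumes ab: "{a..b} \<subseteq> I" and cont: "continuous_on {a..b} f"
    and D: "0 < D" and osc: "\<And>t. \<lbrakk>a \<le> t; t + \<delta> \<le> b\<rbrakk> \<Longrightarrow>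
      \<exists>x\<in>{t..t + \<delta>}. \<exists>y\<in>{t..t + \<delta>}. D * sqrt \<delta> \<le> f y - f x"
    and fin: "finite (SIGMA m1:UNIV. hit_rows \<delta> {(x, f x) | x. x \<in> I} m1)"
    and \<delta>: "0 < \<delta>" "\<delta> \<le> (b - a) / 4" "sqrt \<delta> \<le> D / 2"
  shows "(b - a) * D / 4 / (\<delta> * sqrt \<delta>) \<le> real (mesh_count \<delta> {(x, f x) | x. x \<in> I})"
proof -
  define F where "F = {(x, f x) | x. x \<in> I}"
  let ?J = "{\<lceil>a / \<delta>\<rceil>..\<lfloor>b / \<delta>\<rfloor> - 1}"
  have fin_row: "finite (hit_rows \<delta> F m)" for m
  proof -
    have "hit_rows \<delta> F m = snd ` ((SIGMA m1:UNIV. hit_rows \<delta> F m1) \<inter> {m} \<times> UNIV)"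
      by force
    then show ?thesis
      using fin unfolding F_def by simp
  qed
  have row: "D / (2 * sqrt \<delta>) \<le> real (card (hit_rows \<delta> F m))" if m: "m \<in> ?J" for m
  proof -
    let ?t = "of_int m * \<delta>"
    have "a / \<delta> \<le> of_int m" "real_of_int m + 1 \<le> b / \<delta>"
      using m unfolding atLeastAtMost_iff ceiling_le_iff by linarith+
    then have t: "a \<le> ?t" "?t + \<delta> \<le> b"
      using \<delta>(1) by (simp_all add: field_simps)
    then obtain x y where xy: "x \<in> {?t..?t + \<delta>}" "y \<in> {?t..?t + \<delta>}" "D * sqrt \<delta> \<le> f y - f x"
      using osc by meson
    have "connected (f ` {?t..?t + \<delta>})"
      using t by (intro connected_continuous_image continuous_on_subset [OF cont]) auto
    then have ivt: "{f x..f y} \<subseteq> f ` {?t..?t + \<delta>}"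
      using xy by (intro connected_contains_Icc) auto
    have sub: "{\<lceil>f x / \<delta>\<rceil>..\<lfloor>f y / \<delta>\<rfloor>} \<subseteq> hit_rows \<delta> F m"
    proof
      fix z assume "z \<in> {\<lceil>f x / \<delta>\<rceil>..\<lfloor>f y / \<delta>\<rfloor>}"
      then have "of_int z * \<delta> \<in> {f x..f y}"
        using \<delta>(1) by (simp add: ceiling_le_iff le_floor_iff field_simps)
      then obtain u where u: "u \<in> {?t..?t + \<delta>}" "f u = of_int z * \<delta>"
        using ivt by (metis imageE subsetD)
      then have "u \<in> I"
        using t ab by auto
      then show "z \<in> hit_rows \<delta> F m"
        unfolding F_def hit_rows_graph_iff using u \<delta>(1)
        by (intro bexI [of _ u]) (auto simp: algebra_simps)
    qed
    have "D / sqrt \<delta> = D * sqrt \<delta> / \<delta>"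
      using \<delta>(1) by (simp add: field_simps)
    also have "\<dots> \<le> (f y - f x) / \<delta>"
      using xy \<delta>(1) by (intro divide_right_mono) auto
    finally have "D / sqrt \<delta> - 1 \<le> f y / \<delta> - f x / \<delta> - 1"
      by (simp add: diff_divide_distrib)
    also have "\<dots> \<le> real (card {\<lceil>f x / \<delta>\<rceil>..\<lfloor>f y / \<delta>\<rfloor>})"
      unfolding card_atLeastAtMost_int by linarith
    also have "\<dots> \<le> real (card (hit_rows \<delta> F m))"
      using card_mono [OF fin_row sub] by simp
    finally have "D / sqrt \<delta> - 1 \<le> real (card (hit_rows \<delta> F m))" .
    moreover have "1 \<le> D / (2 * sqrt \<delta>)"
      using \<delta> by (simp add: field_simps)
    moreover have "D / sqrt \<delta> = D / (2 * sqrt \<delta>) + D / (2 * sqrt \<delta>)"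
      by simp
    ultimately show ?thesis
      by linarith
  qed
  have "(b - a) * D / 4 / (\<delta> * sqrt \<delta>) = (b - a) / (2 * \<delta>) * (D / (2 * sqrt \<delta>))"
    by simp
  also have "\<dots> \<le> real (card ?J) * (D / (2 * sqrt \<delta>))"
  proof (rule mult_right_mono)
    have "2 \<le> (b - a) / (2 * \<delta>)"
      using \<delta> by (simp add: field_simps)
    moreover have "b / \<delta> - a / \<delta> - 2 \<le> real (card ?J)"
      unfolding card_atLeastAtMost_int by linarith
    moreover have "b / \<delta> - a / \<delta> = (b - a) / (2 * \<delta>) + (b - a) / (2 * \<delta>)"
      by (simp add: diff_divide_distrib)
    ultimately show "(b - a) / (2 * \<delta>) \<le> real (card ?J)"
      by linarith
  qed (use D \<delta> in simp)
  also have "\<dots> \<le> (\<Sum>m\<in>?J. real (card (hit_rows \<delta> F m)))"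
    using sum_mono [of ?J "\<lambda>_. D / (2 * sqrt \<delta>)", OF row] by simp
  also have "\<dots> = real (card (SIGMA m:?J. hit_rows \<delta> F m))"
    using fin_row by (subst card_SigmaI) auto
  also have "\<dots> \<le> real (mesh_count \<delta> F)"
    unfolding mesh_count_eq [OF \<delta>(1)] of_nat_le_iff
    using fin unfolding F_def by (intro card_mono) auto
  finally show ?thesis
    by (simp only: F_def)
qed

lemma tendsto_box_log_ratio:
  fixes K s :: real
  shows "((\<lambda>\<delta>. (ln K - s * ln \<delta>) / (- ln \<delta>)) \<longlongrightarrow> s) (at_right 0)"
proof -
  have "filterlim (\<lambda>\<delta>::real. - ln \<delta>) at_infinity (at_right 0)"
    using ln_at_0 by (intro filterlim_at_top_imp_at_infinity) (simp add: filterlim_uminus_at_bot)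
  then have "((\<lambda>\<delta>. ln K / (- ln \<delta>) + s) \<longlongrightarrow> 0 + s) (at_right 0)"
    by (intro tendsto_add tendsto_const tendsto_divide_0 [OF tendsto_const])
  moreover have "eventually (\<lambda>\<delta>::real. ln K / (- ln \<delta>) + s = (ln K - s * ln \<delta>) / (- ln \<delta>)) (at_right 0)"
    using eventually_at_right_real [of 0 1]
  proof (rule eventually_mono)
    fix \<delta> :: real assume "\<delta> \<in> {0<..<1}"
    then have "ln \<delta> \<noteq> 0" by simp
    then show "ln K / (- ln \<delta>) + s = (ln K - s * ln \<delta>) / (- ln \<delta>)"
      by (simp add: field_simps)
  qed simp
  ultimately show ?thesis
    by (auto elim: Lim_transform_eventually)
qed

lemma has_box_dim_three_halves:
  assumes "F \<noteq> {}" "bounded F" and K: "0 < K1" "0 < K2"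
    and bounds: "\<forall>\<^sub>F \<delta> in at_right 0. K1 / (\<delta> * sqrt \<delta>) \<le> real (mesh_count \<delta> F) \<and>
      real (mesh_count \<delta> F) \<le> K2 / (\<delta> * sqrt \<delta>)"
  shows "has_box_dim F (3 / 2)"
proof -
  let ?q = "\<lambda>\<delta>. ln (real (mesh_count \<delta> F)) / (- ln \<delta>)"
  have ev: "\<forall>\<^sub>F \<delta> in at_right 0. (ln K1 - 3 / 2 * ln \<delta>) / (- ln \<delta>) \<le> ?q \<delta> \<and>
      ?q \<delta> \<le> (ln K2 - 3 / 2 * ln \<delta>) / (- ln \<delta>)"
    using bounds eventually_at_right_real [of 0 1, OF zero_less_one]
  proof eventually_elim
    case (elim \<delta>)
    then have \<delta>: "0 < \<delta>" "\<delta> < 1" by auto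
    have ln: "ln (K / (\<delta> * sqrt \<delta>)) = ln K - 3 / 2 * ln \<delta>" if "0 < K" for K
      using that \<delta> by (simp add: ln_div ln_mult ln_sqrt)
    have pos: "0 < K1 / (\<delta> * sqrt \<delta>)"
      using K \<delta> by simp
    then have "ln (K1 / (\<delta> * sqrt \<delta>)) \<le> ln (real (mesh_count \<delta> F))"
      "ln (real (mesh_count \<delta> F)) \<le> ln (K2 / (\<delta> * sqrt \<delta>))"
      using elim by (auto intro!: ln_mono elim: less_le_trans)
    then show ?case
      using \<delta> K unfolding ln [OF K(1)] ln [OF K(2)] by (intro conjI divide_right_mono) auto
  qed
  have "(?q \<longlongrightarrow> 3 / 2) (at_right 0)"
    by (rule tendsto_sandwich [OF _ _ tendsto_box_log_ratio tendsto_box_log_ratio])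
      (use ev in \<open>auto elim: eventually_mono\<close>)
  then have "((\<lambda>\<delta>. ereal (?q \<delta>)) \<longlongrightarrow> ereal (3 / 2)) (at_right 0)"
    by simp
  then show ?thesis
    unfolding has_box_dim_def lower_box_dim_def upper_box_dim_def
    using assms(1,2) lim_imp_Liminf lim_imp_Limsup trivial_limit_at_right_real by blast
qed

text \<open>With \<open>h\<close> the largest grid scale below \<open>\<delta> / 2\<close>, a window of length \<open>\<delta>\<close> contains two neighbouring
grid points, and \<open>h\<close> is still comparable to \<open>\<delta>\<close>.\<close>

lemma lambda_fun_column_oscillation:
  fixes a b \<delta> t :: real
  assumes "0 < a" "a \<le> t" "t + \<delta> \<le> b" "0 < \<delta>" "\<delta> \<le> 2"
    and small: "(12 + b) / a * sqrt (\<delta> / 2) \<le> 1 / (2 * sqrt b)"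
  shows "\<exists>x\<in>{t..t + \<delta>}. \<exists>y\<in>{t..t + \<delta>}. 1 / (8 * sqrt b) * sqrt \<delta> \<le> lambda_fun y - lambda_fun x"
proof -
  obtain k where k: "1 / 4 ^ (k + 1) < \<delta> / 2" "\<delta> / 2 \<le> 1 / 4 ^ k"
    using grid_scale_exists [of "\<delta> / 2"] assms by auto
  define h :: real where "h = 1 / 4 ^ (k + 1)"
  define n where "n = nat \<lceil>t * 4 ^ (k + 1)\<rceil>"
  define u where "u = real n / 4 ^ (k + 1)"
  define v where "v = real (n + 1) / 4 ^ (k + 1)"
  have n: "t * 4 ^ (k + 1) \<le> real n" "real n < t * 4 ^ (k + 1) + 1"
  proof -
    have "0 \<le> t * 4 ^ (k + 1)"
      using assms by simp
    then show "t * 4 ^ (k + 1) \<le> real n" "real n < t * 4 ^ (k + 1) + 1"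
      unfolding n_def by linarith+
  qed
  have uv: "t \<le> u" "u \<le> t + h" "v = u + h"
    using n by (auto simp: u_def v_def h_def field_simps)
  have h: "0 < h" "h < \<delta> / 2"
    using k by (auto simp: h_def)
  have mem: "u \<in> {t..t + \<delta>}" "v \<in> {t..t + \<delta>}"
    using uv h by auto
  have scale: "1 / 2 ^ (k + 1) \<le> sqrt (\<delta> / 2)"
    using k(1) by (simp only: sqrt_grid_scale [symmetric] real_sqrt_le_iff)
  have "sqrt (\<delta> / 2) \<le> 1 / 2 ^ k"
    using k(2) by (simp only: sqrt_grid_scale [symmetric] real_sqrt_le_iff)
  moreover have "sqrt \<delta> / 2 \<le> sqrt (\<delta> / 2)"
    using assms by (intro real_le_rsqrt) (simp add: power_divide)
  ultimately have lower: "sqrt \<delta> / 4 \<le> 1 / 2 ^ (k + 1)"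
    by simp
  have "1 / (8 * sqrt b) * sqrt \<delta> = 1 / (2 * sqrt b) * (sqrt \<delta> / 4)"
    by simp
  also have "\<dots> \<le> 1 / (2 * sqrt b) * (1 / 2 ^ (k + 1))"
    using assms by (intro mult_left_mono lower) auto
  also have "\<dots> = 1 / (2 * sqrt b) / 2 ^ (k + 1)"
    by simp
  also have "\<dots> \<le> \<bar>lambda_fun v - lambda_fun u\<bar>"
    unfolding u_def v_def
  proof (rule lambda_fun_grid_oscillation)
    show "0 < a" by fact
    show "a \<le> real n / 4 ^ (k + 1)"
      using uv assms by (simp only: u_def)
    show "real (n + 1) / 4 ^ (k + 1) \<le> b"
      using mem assms by (simp only: v_def) simp
    have "(12 + b) / a / 2 ^ (k + 1) = (12 + b) / a * (1 / 2 ^ (k + 1))"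
      by simp
    also have "\<dots> \<le> (12 + b) / a * sqrt (\<delta> / 2)"
      using assms by (intro mult_left_mono scale) auto
    finally show "(12 + b) / a / 2 ^ (k + 1) \<le> 1 / (2 * sqrt b)"
      using small by linarith
  qed
  finally have "1 / (8 * sqrt b) * sqrt \<delta> \<le> lambda_fun v - lambda_fun u \<or>
      1 / (8 * sqrt b) * sqrt \<delta> \<le> lambda_fun u - lambda_fun v"
    by linarith
  then show ?thesis
    using mem by blast
qed

text \<open>The upper bound uses the whole of \<open>I\<close>, whose infimum may be \<open>0\<close>; for the lower bound a compact
subinterval \<open>[p, q]\<close> away from \<open>0\<close> suffices, as the two bounds only need to agree in the exponent.\<close>

theorem theoremB:
  fixes I :: "real set"
  assumes "is_interval I"
    and "bounded I"
    and "\<exists>a\<in>I. \<exists>b\<in>I. a < b"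
    and "I \<subseteq> {0<..}"
  shows "has_box_dim {(x, lambda_fun x) | x. x \<in> I} (3 / 2)"
proof -
  obtain p q where pq: "p \<in> I" "q \<in> I" "p < q"
    using assms(3) by blast
  have pos: "0 < p" "0 < q"
    using pq assms(4) by auto
  have "{p..q} \<subseteq> I"
    using assms(1) pq by (meson atLeastAtMost_iff mem_is_interval_1_I subsetI)
  obtain b where b: "0 < b" "\<And>x. x \<in> I \<Longrightarrow> \<bar>x\<bar> \<le> b"
    using assms(2) by (auto simp: bounded_pos)
  then have I: "I \<subseteq> {0<..b}"
    using assms(4) by force
  let ?F = "{(x, lambda_fun x) | x. x \<in> I}"
  define D where "D = 1 / (8 * sqrt q)"
  have D: "0 < D"
    using pos by (simp add: D_def)
  define K1 where "K1 = (q - p) * D / 4"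
  define K2 where "K2 = 2 * (12 + b) + 2 + 4 * (30 + b) * sqrt b + 2 * b"
  have bound: "\<bar>lambda_fun x\<bar> \<le> 12 + b" if "x \<in> I" for x
    using that I by (intro lambda_fun_bounded) auto
  have Holder: "\<bar>lambda_fun x - lambda_fun y\<bar> \<le> (30 + b) * sqrt h / sqrt x"
    if "x \<in> I" "y \<in> I" "\<bar>x - y\<bar> \<le> h" "0 < h" "h \<le> 1" for x y h
    using that I by (intro lambda_fun_Holder) auto
  show ?thesis
  proof (rule has_box_dim_three_halves)
    show "?F \<noteq> {}"
      using pq by blast
    have "?F \<subseteq> {0..b} \<times> {- (12 + b)..12 + b}"
      using I bound by (force simp: abs_le_iff)
    then show "bounded ?F"
      by (rule bounded_subset [rotated]) (intro bounded_Times bounded_closed_interval)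
    show "0 < K1"
      using pq D by (simp add: K1_def)
    show "0 < K2"
      using b by (simp add: K2_def add_pos_pos)
    have "((\<lambda>\<delta>. (12 + q) / p * sqrt (\<delta> / 2)) \<longlongrightarrow> (12 + q) / p * sqrt (0 / 2)) (at_right 0)"
      by (intro tendsto_mult tendsto_const tendsto_real_sqrt tendsto_divide tendsto_ident_at; simp)
    then have "\<forall>\<^sub>F \<delta> in at_right 0. (12 + q) / p * sqrt (\<delta> / 2) < 1 / (2 * sqrt q)"
      using pos by (intro order_tendstoD(2)) auto
    moreover have "((\<lambda>\<delta>. sqrt \<delta>) \<longlongrightarrow> sqrt 0) (at_right 0)"
      by (intro tendsto_real_sqrt tendsto_ident_at)
    then have "\<forall>\<^sub>F \<delta> in at_right 0. sqrt \<delta> < D / 2"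
      using D by (intro order_tendstoD(2)) auto
    moreover have "\<forall>\<^sub>F \<delta> in at_right 0. \<delta> \<in> {0<..<min 1 ((q - p) / 4)}"
      using pq by (intro eventually_at_right_real) auto
    ultimately show "\<forall>\<^sub>F \<delta> in at_right 0. K1 / (\<delta> * sqrt \<delta>) \<le> real (mesh_count \<delta> ?F) \<and>
      real (mesh_count \<delta> ?F) \<le> K2 / (\<delta> * sqrt \<delta>)"
    proof eventually_elim
      case (elim \<delta>)
      then have \<delta>: "0 < \<delta>" "\<delta> \<le> 1" "\<delta> \<le> (q - p) / 4" by auto
      note upper = mesh_count_graph_upper [OF I b(1) _ _ bound Holder \<delta>(1,2)]
      show ?case
      proof
        show "real (mesh_count \<delta> ?F) \<le> K2 / (\<delta> * sqrt \<delta>)"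
          unfolding K2_def using b by (intro upper) auto
        show "K1 / (\<delta> * sqrt \<delta>) \<le> real (mesh_count \<delta> ?F)"
          unfolding K1_def
        proof (rule mesh_count_graph_lower)
          show "{p..q} \<subseteq> I" by fact
          show "continuous_on {p..q} lambda_fun"
            using pos by (intro continuous_on_subset [OF continuous_on_lambda_fun]) auto
          show "\<exists>x\<in>{t..t + \<delta>}. \<exists>y\<in>{t..t + \<delta>}. D * sqrt \<delta> \<le> lambda_fun y - lambda_fun x"
            if "p \<le> t" "t + \<delta> \<le> q" for t
            unfolding D_def using that pos \<delta> elim
            by (intro lambda_fun_column_oscillation [of p]) auto
          show "finite (SIGMA m1:UNIV. hit_rows \<delta> ?F m1)"
            using b by (intro upper) auto
        qed (use D \<delta> elim in auto)
      qed
    qed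
  qed
qed

end
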